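(* For a general Humbert sextic K3 surface $X=\mathfrak{G}\cap R$ (i.e., for $R$ in a nonempty Zariski open subset of the space of hyperplanes of $\mathbb{P}^5$), the subgroup of $\operatorname{Aut}(R)\cong\operatorname{Aut}(\mathbb{P}^4)$ consisting of projective automorphisms leaving $X$ invariant is trivial.
   Context: In $\mathbb{P}^5$ with coordinates $(x_1,x_2,x_3,y_1,y_2,y_3)$, the Humbert cubic line complex is $\mathfrak{G}=V(Q,F)$ with $Q=x_1^2+x_2^2+x_3^2+y_1^2+y_2^2+y_3^2$ and $F=x_1x_2x_3+\sqrt{-1}\,y_1y_2y_3$. A Humbert sextic K3 surface is $X=\mathfrak{G}\cap R$ for a hyperplane $R\subset\mathbb{P}^5$ transversal to $\mathfrak{G}$; it is a smooth K3 surface of degree $6$ in $R\cong\mathbb{P}^4$. *)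

theory Defs
  imports "HOL-Analysis.Analysis"
begin

text \<open>Points of C^6 with coordinates (x1,x2,x3,y1,y2,y3) = (v$1,...,v$5,v$6);
  note that in the index type 6 the numeral 6 denotes the sixth index (= 0 mod 6).\<close>

definition humQ :: "complex^6 \<Rightarrow> complex" where
  "humQ v = (v$1)^2 + (v$2)^2 + (v$3)^2 + (v$4)^2 + (v$5)^2 + (v$6)^2"

definition humF :: "complex^6 \<Rightarrow> complex" where
  "humF v = v$1 * v$2 * v$3 + \<i> * (v$4 * v$5 * v$6)"

text \<open>Gradients of Q and F.\<close>
definition gradQ :: "complex^6 \<Rightarrow> complex^6" where
  "gradQ v = (2::complex) *s v"

definition gradF :: "complex^6 \<Rightarrow> complex^6" where
  "gradF v = vector [v$2 * v$3, v$1 * v$3, v$1 * v$2,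
                     \<i> * (v$5 * v$6), \<i> * (v$4 * v$6), \<i> * (v$4 * v$5)]"

text \<open>Hyperplane R = V(r) (as linear subspace of C^6) for r \<noteq> 0.\<close>
definition hyp :: "complex^6 \<Rightarrow> (complex^6) set" where
  "hyp r = {v. (\<Sum>i\<in>UNIV. r$i * v$i) = 0}"

text \<open>Affine cone over X = V(Q,F) \<inter> R.\<close>
definition Xcone :: "complex^6 \<Rightarrow> (complex^6) set" where
  "Xcone r = {v \<in> hyp r. humQ v = 0 \<and> humF v = 0}"

text \<open>R is transversal to the Humbert complex: X is smooth of codimension 3,
  i.e. at every point of X the differentials of Q, F and the linear form r are
  linearly independent.\<close>
definition transversal :: "complex^6 \<Rightarrow> bool" where
  "transversal r \<longleftrightarrow> (\<forall>v \<in> Xcone r. v \<noteq> 0 \<longrightarrow>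
     (\<forall>a b c :: complex. a *s gradQ v + b *s gradF v + c *s r = 0 \<longrightarrow> a = 0 \<and> b = 0 \<and> c = 0))"

text \<open>Polynomial functions on C^6 (explicit finite sums of monomials).\<close>
definition poly_fun :: "(complex^6 \<Rightarrow> complex) \<Rightarrow> bool" where
  "poly_fun P \<longleftrightarrow> (\<exists>(S :: (6 \<Rightarrow> nat) set) (c :: (6 \<Rightarrow> nat) \<Rightarrow> complex). finite S \<and>
      P = (\<lambda>r. \<Sum>\<alpha>\<in>S. c \<alpha> * (\<Prod>i\<in>UNIV. (r$i) ^ (\<alpha> i))))"

text \<open>A projective automorphism of R (represented by a matrix M inducing a linear
  automorphism of the subspace R) leaving X invariant.\<close>
definition preserves_X :: "complex^6 \<Rightarrow> complex^6^6 \<Rightarrow> bool" where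
  "preserves_X r M \<longleftrightarrow> inj_on ((*v) M) (hyp r) \<and> (*v) M ` hyp r = hyp r
      \<and> (*v) M ` Xcone r = Xcone r"

text \<open>It is the identity of P(R): a scalar on R.\<close>
definition trivial_on_R :: "complex^6 \<Rightarrow> complex^6^6 \<Rightarrow> bool" where
  "trivial_on_R r M \<longleftrightarrow> (\<exists>c::complex. \<forall>v \<in> hyp r. M *v v = c *s v)"

end

(*
  For general r, every quadric through X is a multiple of Q on R, and every cubic through X is
  l Q + c F on R with l linear.  Both are seen by restricting to the walls x_i = 0, where F becomes
  a product of three linear forms and Q = 0 is a double plane t^2 = q(y), and then gluing.  Hence an
  automorphism M of X is a similitude for Q and, as F modulo multiples of Q has a unique harmonic
  representative phi on R, it scales phi.  So M scales the covariants of phi: the symmetric operator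
  T with <u, T v> = sum phi(u, e_i, e_j) phi(v, e_i, e_j) and the vector w with
  <u, w> = sum phi(u, e_i, e_j) T_ij.  If tr T is nonzero then M commutes with T; if moreover
  w, T w, ..., T^4 w span R then M is a scalar.  Both conditions are polynomial in r and are checked
  at one point.  R is transversal unless r is isotropic, R contains one of the 34 nodes of the
  complex, or r = a w + grad F(w) with w in the cone over the complex; vectors of the last kind depend
  on five parameters, so by a count of monomials some nonzero polynomial vanishes on all of them.
*)
theory Submission
  imports Defs
begin

section \<open>Polynomial functions\<close>

text \<open>The obstacle is to find all quadrics and cubics through X knowing only that they vanish
  at its points, without ideal theory. On a wall X lies over the three sides of a triangle, and over
  each side it is a double cover, where vanishing is decided by parity in the covering coordinate.
  After gluing, the only freedom left is a multiple of x1 x2 x3, which one point of X off the walls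
  excludes.

  The factors by which an automorphism scales Q and phi are unknown a priori.

  Genericity is a product of polynomials, each nonzero somewhere, so every factor is tested at a
  point of its own. Thus the numerical witness \<open>r0\<close> may lie on the coordinate
  hyperplane \<open>r$1 = 0\<close>, outside the final open set. For transversality an explicit
  factor would be an equation of a dual variety; the monomial count produces a suitable polynomial
  without computing it.\<close>

lemma exhaust_6: "(x::6) = 1 \<or> x = 2 \<or> x = 3 \<or> x = 4 \<or> x = 5 \<or> x = 6"
proof (induct x)
  case (of_int z)
  then have "0 \<le> z" and "z < 6" by simp_all
  \<comment> \<open>The case \<open>z = 0\<close> is the index 6, since \<open>6 = 0\<close> in this
    type.\<close>
  then have "z = 0 \<or> z = 1 \<or> z = 2 \<or> z = 3 \<or> z = 4 \<or> z = 5" by arith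
  then show ?case by auto
qed

lemma UNIV_6: "(UNIV :: 6 set) = {1, 2, 3, 4, 5, 6}"
  using exhaust_6 by auto

lemma forall_6: "(\<forall>i::6. P i) \<longleftrightarrow> P 1 \<and> P 2 \<and> P 3 \<and> P 4 \<and> P 5 \<and> P 6"
  by (metis exhaust_6)

lemma sum_6: "sum f (UNIV :: 6 set) = f 1 + f 2 + f 3 + f 4 + f 5 + f 6"
  unfolding UNIV_6 by (simp add: ac_simps)

lemma vector_6:
  "(vector [a, b, c, d, e, f] :: 'a::zero^6) $ 1 = a"
  "(vector [a, b, c, d, e, f] :: 'a::zero^6) $ 2 = b"
  "(vector [a, b, c, d, e, f] :: 'a::zero^6) $ 3 = c"
  "(vector [a, b, c, d, e, f] :: 'a::zero^6) $ 4 = d"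
  "(vector [a, b, c, d, e, f] :: 'a::zero^6) $ 5 = e"
  "(vector [a, b, c, d, e, f] :: 'a::zero^6) $ 6 = f"
  unfolding vector_def by simp_all

lemma poly_fun_monomial: "poly_fun (\<lambda>r. c * (\<Prod>i\<in>UNIV. (r$i) ^ (\<alpha> i)))"
  unfolding poly_fun_def by (intro exI[of _ "{\<alpha>}"] exI[of _ "\<lambda>_. c"]) simp

lemma poly_fun_add:
  assumes "poly_fun P" "poly_fun Q"
  shows "poly_fun (\<lambda>r. P r + Q r)"
proof -
  obtain S c where S: "finite S" "P = (\<lambda>r. \<Sum>\<alpha>\<in>S. c \<alpha> * (\<Prod>i\<in>UNIV. (r$i) ^ (\<alpha> i)))"
    using assms(1) unfolding poly_fun_def by blast
  obtain T d where T: "finite T" "Q = (\<lambda>r. \<Sum>\<alpha>\<in>T. d \<alpha> * (\<Prod>i\<in>UNIV. (r$i) ^ (\<alpha> i)))"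
    using assms(2) unfolding poly_fun_def by blast
  let ?c = "\<lambda>\<alpha>. (if \<alpha> \<in> S then c \<alpha> else 0) + (if \<alpha> \<in> T then d \<alpha> else 0)"
  let ?m = "\<lambda>(r::complex^6) \<alpha>. \<Prod>i\<in>UNIV. (r$i) ^ (\<alpha> i)"
  have "P r + Q r = (\<Sum>\<alpha>\<in>S \<union> T. ?c \<alpha> * ?m r \<alpha>)" for r
  proof -
    have "(\<Sum>\<alpha>\<in>S \<union> T. ?c \<alpha> * ?m r \<alpha>) =
      (\<Sum>\<alpha>\<in>S \<union> T. (if \<alpha> \<in> S then c \<alpha> * ?m r \<alpha> else 0)) +
      (\<Sum>\<alpha>\<in>S \<union> T. (if \<alpha> \<in> T then d \<alpha> * ?m r \<alpha> else 0))"
      unfolding sum.distrib[symmetric] by (rule sum.cong) (auto simp: distrib_right)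
    also have "(\<Sum>\<alpha>\<in>S \<union> T. (if \<alpha> \<in> S then c \<alpha> * ?m r \<alpha> else 0)) = P r"
      unfolding S(2) using S(1) T(1) by (intro sum.mono_neutral_cong_right) auto
    also have "(\<Sum>\<alpha>\<in>S \<union> T. (if \<alpha> \<in> T then d \<alpha> * ?m r \<alpha> else 0)) = Q r"
      unfolding T(2) using S(1) T(1) by (intro sum.mono_neutral_cong_right) auto
    finally show ?thesis by simp
  qed
  then show ?thesis
    unfolding poly_fun_def using S(1) T(1)
    by (intro exI[of _ "S \<union> T"] exI[of _ ?c]) (auto simp: fun_eq_iff)
qed

lemma poly_fun_const: "poly_fun (\<lambda>r. c)"
  using poly_fun_monomial[of c "\<lambda>_. 0"] by simp

lemma poly_fun_coord: "poly_fun (\<lambda>r. r $ j)"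
proof -
  have "(\<Prod>i\<in>UNIV. (r$i) ^ (if i = j then 1 else 0)) = r $ j" for r :: "complex^6"
    by (subst prod.remove[of _ j]) auto
  then show ?thesis using poly_fun_monomial[of 1 "\<lambda>i. if i = j then 1 else 0"] by simp
qed

lemma poly_fun_sum: "(\<And>a. a \<in> A \<Longrightarrow> poly_fun (P a)) \<Longrightarrow> poly_fun (\<lambda>r. \<Sum>a\<in>A. P a r)"
  by (induction A rule: infinite_finite_induct) (auto intro: poly_fun_const poly_fun_add)

lemma poly_fun_mult:
  assumes "poly_fun P" "poly_fun Q"
  shows "poly_fun (\<lambda>r. P r * Q r)"
proof -
  obtain S c where S: "finite S" "P = (\<lambda>r. \<Sum>\<alpha>\<in>S. c \<alpha> * (\<Prod>i\<in>UNIV. (r$i) ^ (\<alpha> i)))"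
    using assms(1) unfolding poly_fun_def by blast
  obtain T d where T: "finite T" "Q = (\<lambda>r. \<Sum>\<alpha>\<in>T. d \<alpha> * (\<Prod>i\<in>UNIV. (r$i) ^ (\<alpha> i)))"
    using assms(2) unfolding poly_fun_def by blast
  have "(\<lambda>r. P r * Q r) = (\<lambda>r. \<Sum>\<alpha>\<in>S. \<Sum>\<beta>\<in>T. c \<alpha> * d \<beta> * (\<Prod>i\<in>UNIV. (r$i) ^ (\<alpha> i + \<beta> i)))"
    unfolding S(2) T(2) by (simp add: sum_product power_add prod.distrib mult_ac)
  then show ?thesis by (auto intro!: poly_fun_sum poly_fun_monomial)
qed

lemma poly_fun_diff:
  assumes "poly_fun P" "poly_fun Q"
  shows "poly_fun (\<lambda>r. P r - Q r)"
  using poly_fun_add[OF assms(1) poly_fun_mult[OF poly_fun_const[of "-1"] assms(2)]] by simp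

lemma poly_fun_power: "poly_fun P \<Longrightarrow> poly_fun (\<lambda>r. P r ^ n)"
  by (induction n) (auto intro: poly_fun_const poly_fun_mult)

lemma poly_fun_prod: "(\<And>a. a \<in> A \<Longrightarrow> poly_fun (P a)) \<Longrightarrow> poly_fun (\<lambda>r. \<Prod>a\<in>A. P a r)"
  by (induction A rule: infinite_finite_induct) (auto intro: poly_fun_const poly_fun_mult)

lemmas poly_fun_intros = poly_fun_const poly_fun_coord poly_fun_add poly_fun_diff poly_fun_mult
  poly_fun_power poly_fun_sum poly_fun_prod

lemma poly_fun_on_line:
  assumes "poly_fun P"
  shows "\<exists>p. \<forall>t. P (a + t *s d) = poly p t"
proof -
  obtain S c where S: "P = (\<lambda>r. \<Sum>\<alpha>\<in>S. c \<alpha> * (\<Prod>i\<in>UNIV. (r$i) ^ (\<alpha> i)))"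
    using assms unfolding poly_fun_def by blast
  have "\<forall>t. P (a + t *s d) =
      poly (\<Sum>\<alpha>\<in>S. smult (c \<alpha>) (\<Prod>i\<in>UNIV. [:a$i, d$i:] ^ (\<alpha> i))) t"
    unfolding S by (simp add: poly_sum poly_prod poly_power)
  then show ?thesis by blast
qed

definition nontrivial_poly :: "(complex^6 \<Rightarrow> complex) \<Rightarrow> bool" where
  "nontrivial_poly P \<longleftrightarrow> poly_fun P \<and> (\<exists>r. P r \<noteq> 0)"

lemma nontrivial_polyI: "poly_fun P \<Longrightarrow> P r \<noteq> 0 \<Longrightarrow> nontrivial_poly P"
  unfolding nontrivial_poly_def by blast

text \<open>On the line through a point with \<open>P\<close> nonzero and a point with
  \<open>Q\<close> nonzero both restrict to nonzero polynomials in one variable, whose product has a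
  nonroot. This is the irreducibility of affine space, and it lets genericity conditions be tested
  separately.\<close>

lemma nontrivial_poly_mult:
  assumes "nontrivial_poly P" "nontrivial_poly Q"
  shows "nontrivial_poly (\<lambda>r. P r * Q r)"
proof -
  obtain a b where ab: "P a \<noteq> 0" "Q b \<noteq> 0" using assms unfolding nontrivial_poly_def by blast
  obtain p where p: "\<And>t. P (a + t *s (b - a)) = poly p t"
    using assms(1) poly_fun_on_line unfolding nontrivial_poly_def by blast
  obtain q where q: "\<And>t. Q (a + t *s (b - a)) = poly q t"
    using assms(2) poly_fun_on_line unfolding nontrivial_poly_def by blast
  have "p \<noteq> 0" using p[of 0] ab by auto
  moreover have "q \<noteq> 0" using q[of 1] ab by auto
  ultimately obtain t where "poly (p * q) t \<noteq> 0" using poly_all_0_iff_0 by (metis no_zero_divisors)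
  then have "P (a + t *s (b - a)) * Q (a + t *s (b - a)) \<noteq> 0"
    unfolding p q by simp
  then show ?thesis
    using assms unfolding nontrivial_poly_def by (blast intro: poly_fun_mult)
qed

section \<open>Multilinear forms and plane cubics on double covers\<close>

definition dot :: "complex^6 \<Rightarrow> complex^6 \<Rightarrow> complex" where
  "dot u v = (\<Sum>i\<in>UNIV. u$i * v$i)"

definition linear_form :: "(complex^6 \<Rightarrow> complex) \<Rightarrow> bool" where
  "linear_form f \<longleftrightarrow> (\<forall>u v. f (u + v) = f u + f v) \<and> (\<forall>c u. f (c *s u) = c * f u)"

definition bilinear_form :: "(complex^6 \<Rightarrow> complex^6 \<Rightarrow> complex) \<Rightarrow> bool" where
  "bilinear_form b \<longleftrightarrow> (\<forall>v. linear_form (\<lambda>u. b u v)) \<and> (\<forall>u. linear_form (b u))"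

definition trilinear_form :: "(complex^6 \<Rightarrow> complex^6 \<Rightarrow> complex^6 \<Rightarrow> complex) \<Rightarrow> bool" where
  "trilinear_form \<phi> \<longleftrightarrow> (\<forall>v w. linear_form (\<lambda>u. \<phi> u v w)) \<and>
     (\<forall>u w. linear_form (\<lambda>v. \<phi> u v w)) \<and> (\<forall>u v. linear_form (\<phi> u v))"

lemma dot_6: "dot u v = u$1 * v$1 + u$2 * v$2 + u$3 * v$3 + u$4 * v$4 + u$5 * v$5 + u$6 * v$6"
  by (simp add: dot_def sum_6)

lemma hyp_iff_dot: "v \<in> hyp r \<longleftrightarrow> dot r v = 0"
  by (simp add: hyp_def dot_def)

lemma humQ_dot: "humQ v = dot v v"
  by (simp add: humQ_def dot_6 power2_eq_square)

lemma linear_formD: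
  assumes "linear_form f"
  shows "f (u + v) = f u + f v" "f (c *s u) = c * f u" "f (u - v) = f u - f v" "f 0 = 0"
proof -
  show 1: "f (u + v) = f u + f v" "f (c *s u) = c * f u" for u v c
    using assms by (simp_all add: linear_form_def)
  show "f (u - v) = f u - f v" using 1(1)[of "u - v" v] by simp
  show "f 0 = 0" using 1(2)[of 0 0] by simp
qed

lemma bilinear_formD:
  assumes "bilinear_form b"
  shows "b (u + u') v = b u v + b u' v" "b v (u + u') = b v u + b v u'"
    "b (c *s u) v = c * b u v" "b v (c *s u) = c * b v u"
  using assms unfolding bilinear_form_def linear_form_def by blast+

lemma trilinear_formD:
  assumes "trilinear_form \<phi>"
  shows "\<phi> (u + u') v w = \<phi> u v w + \<phi> u' v w" "\<phi> v (u + u') w = \<phi> v u w + \<phi> v u' w"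
    "\<phi> v w (u + u') = \<phi> v w u + \<phi> v w u'"
    "\<phi> (c *s u) v w = c * \<phi> u v w" "\<phi> v (c *s u) w = c * \<phi> v u w"
    "\<phi> v w (c *s u) = c * \<phi> v w u"
  using assms unfolding trilinear_form_def linear_form_def by blast+

section \<open>Binary forms and double covers of the line and the plane\<close>

lemma binary_cubic_eq_0:
  fixes a b c d :: complex
  assumes "\<And>x y. a * x^3 + b * x^2 * y + c * x * y^2 + d * y^3 = 0"
  shows "a = 0 \<and> b = 0 \<and> c = 0 \<and> d = 0"
proof -
  have a: "a = 0" and d: "d = 0" using assms[of 1 0] assms[of 0 1] by simp_all
  have "b + c = 0" "c - b = 0" using assms[of 1 1] assms[of 1 "-1"] a d by simp_all
  then have "2 * c = 0" by (simp add: algebra_simps)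
  then show ?thesis using a d \<open>b + c = 0\<close> by simp
qed

lemma binary_quadric_mult_eq_0:
  fixes a b c a' b' c' :: complex
  assumes "\<And>x y. (a * x^2 + b * x * y + c * y^2) * (a' * x^2 + b' * x * y + c' * y^2) = 0"
  shows "(a = 0 \<and> b = 0 \<and> c = 0) \<or> (a' = 0 \<and> b' = 0 \<and> c' = 0)"
proof -
  have "poly ([:c, b, a:] * [:c', b', a':]) x = 0" for x
    using assms[of x 1] by (simp add: algebra_simps power2_eq_square)
  then have "[:c, b, a:] * [:c', b', a':] = 0" using poly_all_0_iff_0 by blast
  then show ?thesis by auto
qed

text \<open>The four equations in \<open>m\<close> are the coefficients of the product of
  \<open>m1 x + m2 y\<close> with the binary quadric.\<close>

lemma binary_conic_linear_mult_eq_0: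
  fixes m1 m2 :: complex
  assumes q: "q11 \<noteq> 0 \<or> q12 \<noteq> 0 \<or> q22 \<noteq> 0"
    and m: "m1 * q11 = 0" "m1 * q12 + m2 * q11 = 0" "m1 * q22 + m2 * q12 = 0" "m2 * q22 = 0"
  shows "m1 = 0 \<and> m2 = 0"
  using assms by auto

text \<open>These are the coefficients of x^2 + y^2 + N (s1 x + s2 y)^2. A form of rank two plus one
  of rank at most one cannot vanish.\<close>

lemma conic_coeffs_nonzero:
  fixes N s1 s2 :: complex
  assumes "N \<noteq> 0"
  shows "1 + N * s1^2 \<noteq> 0 \<or> 2 * N * s1 * s2 \<noteq> 0 \<or> 1 + N * s2^2 \<noteq> 0"
proof (rule ccontr)
  assume "\<not> ?thesis"
  then have "1 + N * s1^2 = 0" "1 + N * s2^2 = 0" "s1 = 0 \<or> s2 = 0" using assms by auto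
  then show False by auto
qed

text \<open>The parity in \<open>t\<close> splits the vanishing on both points \<open>\<plusminus>t\<close> over a point of the
  projective line into two identities.\<close>
lemma binary_cubic_on_double_cover:
  fixes N :: complex
  assumes N: "N \<noteq> 0" and q: "q11 \<noteq> 0 \<or> q12 \<noteq> 0 \<or> q22 \<noteq> 0"
    and van: "\<forall>t x y. N * t^2 + (q11 * x^2 + q12 * x * y + q22 * y^2) = 0 \<longrightarrow>
      A * t^3 + t^2 * (L1 * x + L2 * y) + t * (h11 * x^2 + h12 * x * y + h22 * y^2)
      + (k1 * x^3 + k2 * x^2 * y + k3 * x * y^2 + k4 * y^3) = 0"
  shows "N * h11 = A * q11" "N * h12 = A * q12" "N * h22 = A * q22"
    "N * k1 = L1 * q11" "N * k2 = L1 * q12 + L2 * q11" "N * k3 = L1 * q22 + L2 * q12"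
    "N * k4 = L2 * q22"
proof -
  have *: "N * (k1 * x^3 + k2 * x^2 * y + k3 * x * y^2 + k4 * y^3)
        = (L1 * x + L2 * y) * (q11 * x^2 + q12 * x * y + q22 * y^2) \<and>
      ((N * h11 - A * q11) * x^2 + (N * h12 - A * q12) * x * y + (N * h22 - A * q22) * y^2)
        * (q11 * x^2 + q12 * x * y + q22 * y^2) = 0" for x y
  proof -
    define q where "q = q11 * x^2 + q12 * x * y + q22 * y^2"
    define h where "h = h11 * x^2 + h12 * x * y + h22 * y^2"
    define k where "k = k1 * x^3 + k2 * x^2 * y + k3 * x * y^2 + k4 * y^3"
    define L where "L = L1 * x + L2 * y"
    define t where "t = csqrt (- q / N)"
    have Nt: "N * t^2 = - q" using N by (simp add: t_def)
    have p: "A * t^3 + t^2 * L + t * h + k = 0"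
      using van[rule_format, of t x y] Nt by (simp add: q_def h_def k_def L_def)
    have m: "- A * t^3 + t^2 * L - t * h + k = 0"
      using van[rule_format, of "-t" x y] Nt by (simp add: q_def h_def k_def L_def)
    have "2 * (t^2 * L + k) = 0" using p m by algebra
    then have e: "t^2 * L + k = 0" by (metis mult_eq_0_iff zero_neq_numeral)
    have "2 * (t * (A * t^2 + h)) = 0" using p m by algebra
    then have o: "t * (A * t^2 + h) = 0" by (metis mult_eq_0_iff zero_neq_numeral)
    have "N * k = L * q" using e Nt by algebra
    \<comment> \<open>The odd part carries a factor \<open>t\<close>, which may vanish at branch
      points. Multiplying by \<open>t\<close> once more turns it into the factor \<open>q\<close>,
      which is cancelled later as a nonzero polynomial.\<close>
    moreover have "(N * h - A * q) * q = 0"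
    proof -
      have "(N * h - A * q) * q = - (N * t) * (N * (t * (A * t^2 + h)))"
        using Nt by algebra
      then show ?thesis using o by simp
    qed
    ultimately show ?thesis unfolding q_def h_def k_def L_def by (simp add: algebra_simps)
  qed
  have "(N * k1 - L1 * q11) * x^3 + (N * k2 - (L1 * q12 + L2 * q11)) * x^2 * y
      + (N * k3 - (L1 * q22 + L2 * q12)) * x * y^2 + (N * k4 - L2 * q22) * y^3 = 0" for x y
    using *[of x y] by algebra
  from binary_cubic_eq_0[OF this]
  show "N * k1 = L1 * q11" "N * k2 = L1 * q12 + L2 * q11" "N * k3 = L1 * q22 + L2 * q12"
    "N * k4 = L2 * q22" by auto
  from binary_quadric_mult_eq_0[OF conjunct2[OF *]] q
  show "N * h11 = A * q11" "N * h12 = A * q12" "N * h22 = A * q22" by auto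
qed

text \<open>The three sides of the triangle y1 y2 y3 = 0 see every coefficient of \<open>f\<close>
  except \<open>k123\<close>, because each other monomial involves at most two of the y variables.
  Comparing coefficients side by side therefore determines everything up to a multiple of y1 y2
  y3.\<close>

lemma cubic_on_double_plane:
  fixes N :: complex
  assumes N: "N \<noteq> 0"
    and f: "\<And>t y1 y2 y3. f t y1 y2 y3 = A * t^3 + t^2 * (L1 * y1 + L2 * y2 + L3 * y3)
    + t * (h11 * y1^2 + h22 * y2^2 + h33 * y3^2 + h12 * y1 * y2 + h13 * y1 * y3 + h23 * y2 * y3)
    + (k111 * y1^3 + k222 * y2^3 + k333 * y3^3 + k112 * y1^2 * y2 + k122 * y1 * y2^2 + k113 * y1^2 * y3
      + k133 * y1 * y3^2 + k223 * y2^2 * y3 + k233 * y2 * y3^2 + k123 * y1 * y2 * y3)"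
    and van: "\<And>t y1 y2 y3. y1 * y2 * y3 = 0 \<Longrightarrow>
      N * t^2 + (y1^2 + y2^2 + y3^2 + N * (s1 * y1 + s2 * y2 + s3 * y3)^2) = 0 \<Longrightarrow> f t y1 y2 y3 = 0"
  shows "\<exists>c. \<forall>t y1 y2 y3. N * f t y1 y2 y3 = (A * t + L1 * y1 + L2 * y2 + L3 * y3)
      * (N * t^2 + (y1^2 + y2^2 + y3^2 + N * (s1 * y1 + s2 * y2 + s3 * y3)^2)) + c * (y1 * y2 * y3)"
proof -
  have "\<forall>t x y. N * t^2 + ((1 + N * s1^2) * x^2 + (2 * N * s1 * s2) * x * y + (1 + N * s2^2) * y^2) = 0 \<longrightarrow>
      A * t^3 + t^2 * (L1 * x + L2 * y) + t * (h11 * x^2 + h12 * x * y + h22 * y^2)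
      + (k111 * x^3 + k112 * x^2 * y + k122 * x * y^2 + k222 * y^3) = 0"
  proof (intro allI impI, goal_cases)
    case (1 t x y)
    then show ?case using van[of x y 0 t] f[of t x y 0] by (simp add: algebra_simps power2_eq_square)
  qed
  note P12 = binary_cubic_on_double_cover[OF N conic_coeffs_nonzero[OF N] this]
  have "\<forall>t x y. N * t^2 + ((1 + N * s1^2) * x^2 + (2 * N * s1 * s3) * x * y + (1 + N * s3^2) * y^2) = 0 \<longrightarrow>
      A * t^3 + t^2 * (L1 * x + L3 * y) + t * (h11 * x^2 + h13 * x * y + h33 * y^2)
      + (k111 * x^3 + k113 * x^2 * y + k133 * x * y^2 + k333 * y^3) = 0"
  proof (intro allI impI, goal_cases)
    case (1 t x y)
    then show ?case using van[of x 0 y t] f[of t x 0 y] by (simp add: algebra_simps power2_eq_square)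
  qed
  note P13 = binary_cubic_on_double_cover[OF N conic_coeffs_nonzero[OF N] this]
  have "\<forall>t x y. N * t^2 + ((1 + N * s2^2) * x^2 + (2 * N * s2 * s3) * x * y + (1 + N * s3^2) * y^2) = 0 \<longrightarrow>
      A * t^3 + t^2 * (L2 * x + L3 * y) + t * (h22 * x^2 + h23 * x * y + h33 * y^2)
      + (k222 * x^3 + k223 * x^2 * y + k233 * x * y^2 + k333 * y^3) = 0"
  proof (intro allI impI, goal_cases)
    case (1 t x y)
    then show ?case using van[of 0 x y t] f[of t 0 x y] by (simp add: algebra_simps power2_eq_square)
  qed
  note P23 = binary_cubic_on_double_cover[OF N conic_coeffs_nonzero[OF N] this]
  \<comment> \<open>The discrepancy at the monomial y1 y2 y3: the subtracted part is its coefficient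
    in the product of the linear form with the quadric, coming from the cross terms of the
    square.\<close>
  define c where "c = N * k123 - 2 * N * (L1 * s2 * s3 + L2 * s1 * s3 + L3 * s1 * s2)"
  have "N * f t y1 y2 y3 = (A * t + L1 * y1 + L2 * y2 + L3 * y3)
      * (N * t^2 + (y1^2 + y2^2 + y3^2 + N * (s1 * y1 + s2 * y2 + s3 * y3)^2)) + c * (y1 * y2 * y3)"
    for t y1 y2 y3
  proof -
    have "N * f t y1 y2 y3 = N * A * t^3 + N * t^2 * (L1 * y1 + L2 * y2 + L3 * y3)
      + t * ((N * h11) * y1^2 + (N * h22) * y2^2 + (N * h33) * y3^2 + (N * h12) * y1 * y2
        + (N * h13) * y1 * y3 + (N * h23) * y2 * y3)
      + ((N * k111) * y1^3 + (N * k222) * y2^3 + (N * k333) * y3^3 + (N * k112) * y1^2 * y2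
        + (N * k122) * y1 * y2^2 + (N * k113) * y1^2 * y3 + (N * k133) * y1 * y3^2
        + (N * k223) * y2^2 * y3 + (N * k233) * y2 * y3^2
        + (c + 2 * N * (L1 * s2 * s3 + L2 * s1 * s3 + L3 * s1 * s2)) * y1 * y2 * y3)"
      unfolding f c_def by algebra
    also have "\<dots> = (A * t + L1 * y1 + L2 * y2 + L3 * y3)
      * (N * t^2 + (y1^2 + y2^2 + y3^2 + N * (s1 * y1 + s2 * y2 + s3 * y3)^2)) + c * (y1 * y2 * y3)"
      unfolding P12 P13 P23 by algebra
    finally show ?thesis .
  qed
  then show ?thesis by blast
qed

text \<open>As \<open>\<phi>\<close> is not assumed symmetric, each mixed coefficient is a sum over
  the distinct orderings of its arguments.\<close>

lemma trilinear_form_on_span4: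
  assumes "trilinear_form \<phi>"
  shows "\<exists>A L1 L2 L3 h11 h22 h33 h12 h13 h23 k111 k222 k333 k112 k122 k113 k133 k223 k233 k123. \<forall>t y1 y2 y3.
    (let v = t *s n + y1 *s u1 + y2 *s u2 + y3 *s u3 in \<phi> v v v) = A * t^3 + t^2 * (L1 * y1 + L2 * y2 + L3 * y3)
    + t * (h11 * y1^2 + h22 * y2^2 + h33 * y3^2 + h12 * y1 * y2 + h13 * y1 * y3 + h23 * y2 * y3)
    + (k111 * y1^3 + k222 * y2^3 + k333 * y3^3 + k112 * y1^2 * y2 + k122 * y1 * y2^2 + k113 * y1^2 * y3
      + k133 * y1 * y3^2 + k223 * y2^2 * y3 + k233 * y2 * y3^2 + k123 * y1 * y2 * y3)"
  unfolding Let_def trilinear_formD[OF assms]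
  by (
    rule exI[of _ "(\<phi> n n n)"],
    rule exI[of _ "(\<phi> n n u1 + \<phi> n u1 n + \<phi> u1 n n)"],
    rule exI[of _ "(\<phi> n n u2 + \<phi> n u2 n + \<phi> u2 n n)"],
    rule exI[of _ "(\<phi> n n u3 + \<phi> n u3 n + \<phi> u3 n n)"],
    rule exI[of _ "(\<phi> n u1 u1 + \<phi> u1 n u1 + \<phi> u1 u1 n)"],
    rule exI[of _ "(\<phi> n u2 u2 + \<phi> u2 n u2 + \<phi> u2 u2 n)"],
    rule exI[of _ "(\<phi> n u3 u3 + \<phi> u3 n u3 + \<phi> u3 u3 n)"],
    rule exI[of _ "(\<phi> n u1 u2 + \<phi> n u2 u1 + \<phi> u1 n u2 + \<phi> u1 u2 n + \<phi> u2 n u1 + \<phi> u2 u1 n)"],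
    rule exI[of _ "(\<phi> n u1 u3 + \<phi> n u3 u1 + \<phi> u1 n u3 + \<phi> u1 u3 n + \<phi> u3 n u1 + \<phi> u3 u1 n)"],
    rule exI[of _ "(\<phi> n u2 u3 + \<phi> n u3 u2 + \<phi> u2 n u3 + \<phi> u2 u3 n + \<phi> u3 n u2 + \<phi> u3 u2 n)"],
    rule exI[of _ "(\<phi> u1 u1 u1)"],
    rule exI[of _ "(\<phi> u2 u2 u2)"],
    rule exI[of _ "(\<phi> u3 u3 u3)"],
    rule exI[of _ "(\<phi> u1 u1 u2 + \<phi> u1 u2 u1 + \<phi> u2 u1 u1)"],
    rule exI[of _ "(\<phi> u1 u2 u2 + \<phi> u2 u1 u2 + \<phi> u2 u2 u1)"],
    rule exI[of _ "(\<phi> u1 u1 u3 + \<phi> u1 u3 u1 + \<phi> u3 u1 u1)"],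
    rule exI[of _ "(\<phi> u1 u3 u3 + \<phi> u3 u1 u3 + \<phi> u3 u3 u1)"],
    rule exI[of _ "(\<phi> u2 u2 u3 + \<phi> u2 u3 u2 + \<phi> u3 u2 u2)"],
    rule exI[of _ "(\<phi> u2 u3 u3 + \<phi> u3 u2 u3 + \<phi> u3 u3 u2)"],
    rule exI[of _ "(\<phi> u1 u2 u3 + \<phi> u1 u3 u2 + \<phi> u2 u1 u3 + \<phi> u2 u3 u1 + \<phi> u3 u1 u2 + \<phi> u3 u2 u1)"],
    simp only: power2_eq_square power3_eq_cube, simp add: algebra_simps)

section \<open>Cubics on the hyperplane sections by coordinate walls\<close>

text \<open>The sums of squares are the leading coefficients \<open>N\<close> of the double planes
  on the walls; the last three conditions provide a point of X off the walls.\<close>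

definition generic_coords :: "complex^6 \<Rightarrow> bool" where
  "generic_coords r \<longleftrightarrow> (\<forall>i. r$i \<noteq> 0) \<and> (r$1)^2 + (r$2)^2 \<noteq> 0 \<and> (r$1)^2 + (r$3)^2 \<noteq> 0 \<and>
     (r$2)^2 + (r$3)^2 \<noteq> 0 \<and>
     \<i> * r$1 + r$4 \<noteq> 0 \<and> \<i> * r$2 + r$5 \<noteq> 0 \<and> \<i> * r$3 + r$6 \<noteq> 0"

text \<open>The vector \<open>n\<close> spans the direction in the plane of x_j and x_k that is
  annihilated by \<open>r\<close>, and each \<open>u m\<close> is a y axis moved into the hyperplane
  by a vector orthogonal to \<open>n\<close>. Hence Q has no mixed terms in \<open>t\<close> and y,
  which is what makes its zero set a double plane over the y coordinates.\<close>

lemma wall_parametrization: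
  fixes r :: "complex^6"
  assumes ijk: "(i,j,k) \<in> {(1,2,3),(2,1,3),(3,1,2)}" and N: "N = (r$j)^2 + (r$k)^2" "N \<noteq> 0"
  shows "\<exists>n u1 u2 u3.
    (\<forall>v\<in>hyp r. v$i = 0 \<longrightarrow>
       v = ((r$k * v$j - r$j * v$k) / N) *s n + v$4 *s u1 + v$5 *s u2 + v$6 *s u3) \<and>
    (\<forall>t y1 y2 y3 v. v = t *s n + y1 *s u1 + y2 *s u2 + y3 *s u3 \<longrightarrow>
       v \<in> hyp r \<and> v$i = 0 \<and>
       humQ v = N * t^2 + (y1^2 + y2^2 + y3^2 + N * (r$4 / N * y1 + r$5 / N * y2 + r$6 / N * y3)^2) \<and>
       humF v = \<i> * (y1 * y2 * y3))"
proof -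
  define n :: "complex^6" where "n = (\<chi> a. if a = j then r$k else if a = k then - r$j else 0)"
  define u :: "6 \<Rightarrow> complex^6" where
    "u m = (\<chi> a. if a = j \<or> a = k then - (r$m / N) * r$a else if a = m then 1 else 0)" for m
  have rr: "(r$j)^2 / N + (r$k)^2 / N = 1" using N by (simp flip: add_divide_distrib)
  show ?thesis
  proof (rule exI[of _ n], rule exI[of _ "u 4"], rule exI[of _ "u 5"], rule exI[of _ "u 6"],
      intro conjI[of "Ball _ _"] ballI allI impI)
    fix v assume v: "v \<in> hyp r" "v$i = 0"
    let ?t = "(r$k * v$j - r$j * v$k) / N"
    let ?s = "r$4 / N * v$4 + r$5 / N * v$5 + r$6 / N * v$6"
    have 0: "r$j * v$j + r$k * v$k + (r$4 * v$4 + r$5 * v$5 + r$6 * v$6) = 0"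
      using v ijk by (auto simp: hyp_iff_dot dot_6 algebra_simps)
    then have s: "N * ?s = - (r$j * v$j + r$k * v$k)"
    proof -
      have "N * ?s = r$4 * v$4 + r$5 * v$5 + r$6 * v$6" using N(2) by (simp add: field_simps)
      with 0 show ?thesis by algebra
    qed
    have tN: "N * ?t = r$k * v$j - r$j * v$k" using N(2) by simp
    \<comment> \<open>The relations \<open>s\<close> and \<open>tN\<close> are a linear system for
      \<open>v$j\<close> and \<open>v$k\<close> with determinant \<open>- N\<close>.\<close>
    have "N * v$j = N * (?t * r$k - ?s * r$j)"
      using s tN N(1) by algebra
    then have j: "v$j = ?t * r$k - ?s * r$j" using N(2) by (simp only: mult_cancel_left) simp
    have "N * v$k = N * (- ?t * r$j - ?s * r$k)"
      using s tN N(1) by algebra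
    then have k: "v$k = - ?t * r$j - ?s * r$k" using N(2) by (simp only: mult_cancel_left) simp
    show "v = ?t *s n + v$4 *s u 4 + v$5 *s u 5 + v$6 *s u 6"
      unfolding vec_eq_iff forall_6 using ijk v(2) j k
      by (auto simp: n_def u_def algebra_simps diff_divide_distrib)
  next
    fix t y1 y2 y3 v assume v: "v = t *s n + y1 *s u 4 + y2 *s u 5 + y3 *s u 6"
    define s where "s = r$4 / N * y1 + r$5 / N * y2 + r$6 / N * y3"
    have Ns: "N * s = r$4 * y1 + r$5 * y2 + r$6 * y3" using N(2) by (simp add: s_def field_simps)
    have c: "v$i = 0" "v$j = t * r$k - s * r$j" "v$k = - t * r$j - s * r$k"
      "v$4 = y1" "v$5 = y2" "v$6 = y3"
      using ijk unfolding v s_def by (auto simp: n_def u_def algebra_simps)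
    have "dot r v = r$j * v$j + r$k * v$k + (r$4 * y1 + r$5 * y2 + r$6 * y3)"
      using ijk c(1,4,5,6) by (auto simp: dot_6 algebra_simps)
    also have "\<dots> = 0" using c(2,3) Ns N(1) by algebra
    finally have h: "v \<in> hyp r" by (simp add: hyp_iff_dot)
    have "humQ v = (v$j)^2 + (v$k)^2 + (y1^2 + y2^2 + y3^2)"
      using ijk c(1,4,5,6) by (auto simp: humQ_def algebra_simps)
    also have "\<dots> = N * t^2 + (y1^2 + y2^2 + y3^2 + N * s^2)" using c(2,3) N(1) by algebra
    finally have q: "humQ v = \<dots>" .
    have "humF v = \<i> * (y1 * y2 * y3)" using ijk c(1,4,5,6) by (auto simp: humF_def)
    then show "v \<in> hyp r \<and> v$i = 0 \<and>
       humQ v = N * t^2 + (y1^2 + y2^2 + y3^2 + N * (r$4 / N * y1 + r$5 / N * y2 + r$6 / N * y3)^2) \<and>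
       humF v = \<i> * (y1 * y2 * y3)" using h q c(1) unfolding s_def by blast
  qed
qed

lemma cubic_on_wall:
  fixes r :: "complex^6"
  assumes ijk: "(i,j,k) \<in> {(1,2,3),(2,1,3),(3,1,2)}" and N0: "(r$j)^2 + (r$k)^2 \<noteq> 0"
    and \<phi>: "trilinear_form \<phi>" and van: "\<And>v. v \<in> Xcone r \<Longrightarrow> \<phi> v v v = 0"
  shows "\<exists>l c. linear_form l \<and> (\<forall>v\<in>hyp r. v$i = 0 \<longrightarrow> \<phi> v v v = l v * humQ v + c * humF v)"
proof -
  define N where "N = (r$j)^2 + (r$k)^2"
  have N: "N \<noteq> 0" using N0 by (simp add: N_def)
  obtain n u1 u2 u3 :: "complex^6" where
    w1: "\<And>v. v \<in> hyp r \<Longrightarrow> v$i = 0 \<Longrightarrow>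
       v = ((r$k * v$j - r$j * v$k) / N) *s n + v$4 *s u1 + v$5 *s u2 + v$6 *s u3" and
    w2: "\<And>t y1 y2 y3 v. v = t *s n + y1 *s u1 + y2 *s u2 + y3 *s u3 \<Longrightarrow>
       v \<in> hyp r \<and> v$i = 0 \<and>
       humQ v = N * t^2 + (y1^2 + y2^2 + y3^2 + N * (r$4 / N * y1 + r$5 / N * y2 + r$6 / N * y3)^2) \<and>
       humF v = \<i> * (y1 * y2 * y3)"
    using wall_parametrization[OF ijk N_def N] by blast
  define f where "f t y1 y2 y3 = (let v = t *s n + y1 *s u1 + y2 *s u2 + y3 *s u3 in \<phi> v v v)"
    for t y1 y2 y3
  have vf: "f t y1 y2 y3 = 0" if y: "y1 * y2 * y3 = 0" and
     q: "N * t^2 + (y1^2 + y2^2 + y3^2 + N * (r$4 / N * y1 + r$5 / N * y2 + r$6 / N * y3)^2) = 0"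
   for t y1 y2 y3
  proof -
    have "t *s n + y1 *s u1 + y2 *s u2 + y3 *s u3 \<in> Xcone r"
      using w2[of _ t y1 y2 y3, OF refl] y q unfolding Xcone_def by (metis (mono_tags, lifting) mem_Collect_eq mult_zero_right)
    then show ?thesis using van by (simp add: f_def Let_def)
  qed
  obtain A L1 L2 L3 h11 h22 h33 h12 h13 h23 k111 k222 k333 k112 k122 k113 k133 k223 k233 k123
    where f: "\<And>t y1 y2 y3. f t y1 y2 y3 = A * t^3 + t^2 * (L1 * y1 + L2 * y2 + L3 * y3)
    + t * (h11 * y1^2 + h22 * y2^2 + h33 * y3^2 + h12 * y1 * y2 + h13 * y1 * y3 + h23 * y2 * y3)
    + (k111 * y1^3 + k222 * y2^3 + k333 * y3^3 + k112 * y1^2 * y2 + k122 * y1 * y2^2 + k113 * y1^2 * y3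
      + k133 * y1 * y3^2 + k223 * y2^2 * y3 + k233 * y2 * y3^2 + k123 * y1 * y2 * y3)"
    using trilinear_form_on_span4[OF \<phi>, of n u1 u2 u3, folded f_def] by metis
  obtain c where F: "\<And>t y1 y2 y3. N * f t y1 y2 y3 = (A * t + L1 * y1 + L2 * y2 + L3 * y3)
      * (N * t^2 + (y1^2 + y2^2 + y3^2 + N * (r$4 / N * y1 + r$5 / N * y2 + r$6 / N * y3)^2)) + c * (y1 * y2 * y3)"
    using cubic_on_double_plane[OF N f vf] by blast
  define l where "l v = (A * ((r$k * v$j - r$j * v$k) / N) + L1 * v$4 + L2 * v$5 + L3 * v$6) / N"
    for v :: "complex^6"
  have "linear_form l"
    unfolding linear_form_def l_def by (simp add: field_simps add_divide_distrib diff_divide_distrib)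
  moreover have "\<phi> v v v = l v * humQ v + c / (\<i> * N) * humF v" if "v \<in> hyp r" "v$i = 0" for v
  proof -
    let ?t = "(r$k * v$j - r$j * v$k) / N"
    note w = w1[OF that]
    have f: "\<phi> v v v = f ?t (v$4) (v$5) (v$6)" unfolding f_def Let_def using w by simp
    have "N * \<phi> v v v = (N * l v) * humQ v + c * (v$4 * v$5 * v$6)"
      using w2[OF w] F[of ?t "v$4" "v$5" "v$6"] N unfolding f l_def by simp
    moreover have "c * (v$4 * v$5 * v$6) = N * (c / (\<i> * N) * humF v)" using w2[OF w] N by simp
    ultimately have "N * \<phi> v v v = N * (l v * humQ v + c / (\<i> * N) * humF v)"
      by (simp add: algebra_simps)
    then show ?thesis using N by (simp only: mult_cancel_left) simp
  qed
  ultimately show ?thesis by blast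
qed

text \<open>Uniqueness on the intersection of two walls, needed for gluing. There F is a multiple of
  y1 y2 y3, so setting one y coordinate to zero kills the right side while Q stays a nonzero
  quadric; this forces the linear form to vanish, and then \<open>c\<close>.\<close>

lemma linear_mult_Q_eq_F:
  fixes r :: "complex^6"
  assumes ijk: "(i,j,k) \<in> {(1,2,3),(1,3,2),(2,3,1)}" and rk: "r$k \<noteq> 0" and l: "linear_form l"
    and eq: "\<And>v. v \<in> hyp r \<Longrightarrow> v$i = 0 \<Longrightarrow> v$j = 0 \<Longrightarrow> l v * humQ v = c * humF v"
  shows "c = 0 \<and> (\<forall>v\<in>hyp r. v$i = 0 \<longrightarrow> v$j = 0 \<longrightarrow> l v = 0)"
proof -
  define N where "N = (r$k)^2"
  have N: "N \<noteq> 0" using rk by (simp add: N_def)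
  define s where "s m = r$m / N" for m
  define w :: "6 \<Rightarrow> complex^6" where
    "w m = (\<chi> a. if a = k then - s m * r$k else if a = m then 1 else 0)" for m
  define m where "m a = l (w a)" for a
  have *: "(m 4 * y1 + m 5 * y2 + m 6 * y3) *
      (y1^2 + y2^2 + y3^2 + N * (s 4 * y1 + s 5 * y2 + s 6 * y3)^2) = c * (\<i> * (y1 * y2 * y3))"
    for y1 y2 y3
  proof -
    define v where "v = y1 *s w 4 + y2 *s w 5 + y3 *s w 6"
    have v: "v$i = 0" "v$j = 0" "v$4 = y1" "v$5 = y2" "v$6 = y3"
      "v$k = - (s 4 * y1 + s 5 * y2 + s 6 * y3) * r$k"
      using ijk by (auto simp: v_def w_def algebra_simps)
    have "N * (s 4 * y1 + s 5 * y2 + s 6 * y3) = r$4 * y1 + r$5 * y2 + r$6 * y3"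
      using N by (simp add: s_def field_simps)
    moreover have "dot r v = r$k * v$k + (r$4 * y1 + r$5 * y2 + r$6 * y3)"
      using ijk v by (auto simp: dot_6)
    ultimately have h: "v \<in> hyp r" unfolding hyp_iff_dot using v(6) N_def by algebra
    have "humQ v = (v$k)^2 + (y1^2 + y2^2 + y3^2)" using ijk v by (auto simp: humQ_def)
    then have q: "humQ v = y1^2 + y2^2 + y3^2 + N * (s 4 * y1 + s 5 * y2 + s 6 * y3)^2"
      using v(6) N_def by algebra
    have "humF v = \<i> * (y1 * y2 * y3)" using ijk v by (auto simp: humF_def)
    moreover have "l v = m 4 * y1 + m 5 * y2 + m 6 * y3"
      unfolding v_def m_def by (simp add: linear_formD[OF l])
    ultimately show ?thesis using eq[OF h v(1,2)] q by simp
  qed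
  have plane: "m a = 0 \<and> m b = 0"
    if "\<And>x y. (m a * x + m b * y) * (x^2 + y^2 + N * (s a * x + s b * y)^2) = 0" for a b
  proof -
    have "(m a * (1 + N * (s a)^2)) * x^3 + (m a * (2 * N * s a * s b) + m b * (1 + N * (s a)^2)) * x^2 * y
      + (m a * (1 + N * (s b)^2) + m b * (2 * N * s a * s b)) * x * y^2 + (m b * (1 + N * (s b)^2)) * y^3 = 0"
      for x y using that[of x y] by algebra
    from binary_cubic_eq_0[OF this] show ?thesis
      using binary_conic_linear_mult_eq_0[OF conic_coeffs_nonzero[OF N]] by blast
  qed
  have m: "m 4 = 0" "m 5 = 0" "m 6 = 0"
    using plane[of 4 5] plane[of 4 6] *[of _ _ 0] *[of _ 0 _] by simp_all
  have "c = 0" using *[of 1 1 1] m by simp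
  moreover have "l v = 0" if v: "v \<in> hyp r" "v$i = 0" "v$j = 0" for v
  proof -
    have "r$k * v$k + (r$4 * v$4 + r$5 * v$5 + r$6 * v$6) = 0"
      using v ijk by (auto simp: hyp_iff_dot dot_6 algebra_simps)
    moreover have "N * (s 4 * v$4 + s 5 * v$5 + s 6 * v$6) = r$4 * v$4 + r$5 * v$5 + r$6 * v$6"
      using N by (simp add: s_def field_simps)
    ultimately have "r$k * v$k = r$k * (- (s 4 * v$4 + s 5 * v$5 + s 6 * v$6) * r$k)"
      using N_def by algebra
    then have "v$k = - (s 4 * v$4 + s 5 * v$5 + s 6 * v$6) * r$k" using rk by simp
    then have "v = v$4 *s w 4 + v$5 *s w 5 + v$6 *s w 6"
      unfolding vec_eq_iff forall_6 using ijk v(2,3) by (auto simp: w_def algebra_simps)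
    then have "l v = v$4 * m 4 + v$5 * m 5 + v$6 * m 6"
      unfolding m_def by (metis linear_formD(1,2)[OF l])
    then show ?thesis using m by simp
  qed
  ultimately show ?thesis by blast
qed

section \<open>Quadrics and cubics through X\<close>

lemma trilinear_form_diff:
  assumes "trilinear_form \<phi>" "trilinear_form \<psi>"
  shows "trilinear_form (\<lambda>u v w. \<phi> u v w - \<psi> u v w)"
  unfolding trilinear_form_def linear_form_def
  by (simp add: trilinear_formD[OF assms(1)] trilinear_formD[OF assms(2)] algebra_simps)

lemma trilinear_form_linear_bilinear:
  assumes "linear_form l" "bilinear_form b"
  shows "trilinear_form (\<lambda>u v w. l u * b v w)"
  unfolding trilinear_form_def linear_form_def
  by (simp add: linear_formD[OF assms(1)] bilinear_formD[OF assms(2)] algebra_simps)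

lemma bilinear_form_dot: "bilinear_form dot"
  unfolding bilinear_form_def linear_form_def by (simp add: dot_6 algebra_simps)

lemma trilinear_form_F:
  "trilinear_form (\<lambda>u v w. c * (u$1 * v$2 * w$3 + \<i> * (u$4 * v$5 * w$6)))"
  unfolding trilinear_form_def linear_form_def by (simp add: algebra_simps)

text \<open>The third difference of a cubic does not depend on the base point \<open>z\<close>. When
  \<open>g\<close> vanishes on the walls, only the symmetrized term at three wall directions
  survives.\<close>

lemma trilinear_form_third_difference:
  assumes "trilinear_form \<phi>"
  defines "g \<equiv> \<lambda>v. \<phi> v v v"
  shows "g (a + b + c + z) = g (b + c + z) + g (a + c + z) + g (a + b + z)
      - g (a + z) - g (b + z) - g (c + z) + g z
      + (\<phi> a b c + \<phi> a c b + \<phi> b a c + \<phi> b c a + \<phi> c a b + \<phi> c b a)"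
  unfolding g_def trilinear_formD[OF assms(1)] by simp

section \<open>Gluing the walls of one generic hyperplane\<close>

context
  fixes r :: "complex^6"
  assumes gen: "generic_coords r"
begin

lemma generic_coords_nz: "r$i \<noteq> 0"
  using gen by (simp add: generic_coords_def)

text \<open>Modulo \<open>e\<^sub>6\<close>, the vectors \<open>e\<^sub>1, \<dots>, e\<^sub>5\<close> moved into the hyperplane.\<close>
definition hyp_axis :: "6 \<Rightarrow> complex^6" where
  "hyp_axis m = (\<chi> a. if a = m then 1 else if a = 6 then - r$m / r$6 else 0)"

lemma hyp_axis_nth: "hyp_axis m $ a = (if a = m then 1 else if a = 6 then - r$m / r$6 else 0)"
  by (simp add: hyp_axis_def)

lemma hyp_axis_in_hyp: "m \<in> {1,2,3} \<Longrightarrow> hyp_axis m \<in> hyp r"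
  using generic_coords_nz by (auto simp: hyp_iff_dot dot_6 hyp_axis_nth)

lemma hyp_add: "u \<in> hyp r \<Longrightarrow> v \<in> hyp r \<Longrightarrow> u + v \<in> hyp r"
  by (simp add: hyp_iff_dot bilinear_formD[OF bilinear_form_dot])

lemma hyp_scale: "u \<in> hyp r \<Longrightarrow> c *s u \<in> hyp r"
  by (simp add: hyp_iff_dot bilinear_formD[OF bilinear_form_dot])

lemma hyp_diff: "u \<in> hyp r \<Longrightarrow> v \<in> hyp r \<Longrightarrow> u - v \<in> hyp r"
  using hyp_add[of u "(-1) *s v"] hyp_scale[of v "-1"] by simp

text \<open>The complex contains the plane \<open>x = \<i>y\<close>, which meets the hyperplane in a line.\<close>
lemma point_on_X_off_axes: "\<exists>v\<in>Xcone r. v$1 * v$2 * v$3 \<noteq> 0"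
proof -
  define a b c where abc: "a = \<i> * r$1 + r$4" "b = \<i> * r$2 + r$5" "c = \<i> * r$3 + r$6"
  have nz: "a \<noteq> 0" "b \<noteq> 0" "c \<noteq> 0" using gen by (simp_all add: abc generic_coords_def)
  \<comment> \<open>On this plane the equation of the hyperplane reads a y1 + b y2 + c y3 = 0, and
    (bc, ac, -2ab) is a solution with no zero coordinate.\<close>
  define v :: "complex^6" where
    "v = vector [\<i> * (b * c), \<i> * (a * c), \<i> * (- 2 * a * b), b * c, a * c, - 2 * a * b]"
  note v = vector_6[of "\<i> * (b * c)" "\<i> * (a * c)" "\<i> * (- 2 * a * b)" "b * c" "a * c" "- 2 * a * b",
      folded v_def]
  have "dot r v = a * (b * c) + b * (a * c) + c * (- 2 * a * b)"
    by (simp add: dot_6 v abc algebra_simps)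
  then have "v \<in> hyp r" by (simp add: hyp_iff_dot)
  moreover have "humQ v = 0" by (simp add: humQ_def v power_mult_distrib)
  moreover have "humF v = 0" by (simp add: humF_def v)
  ultimately have "v \<in> Xcone r" by (simp add: Xcone_def)
  then show ?thesis using nz by (intro bexI[of _ v]) (simp_all add: v)
qed

text \<open>The subspaces x1 = x2 = 0 and x1 = x3 = 0 of the hyperplane together span its wall x1 =
  0, so it is enough that \<open>l\<close> vanishes on both.\<close>

lemma linear_mult_Q_eq_F_on_wall:
  assumes l: "linear_form l"
    and eq: "\<And>v. v \<in> hyp r \<Longrightarrow> v$1 = 0 \<Longrightarrow> l v * humQ v = c * humF v"
  shows "c = 0 \<and> (\<forall>v\<in>hyp r. v$1 = 0 \<longrightarrow> l v = 0)"
proof -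
  have 2: "c = 0 \<and> (\<forall>v\<in>hyp r. v$1 = 0 \<longrightarrow> v$2 = 0 \<longrightarrow> l v = 0)"
    using linear_mult_Q_eq_F[of 1 2 3 r l c] generic_coords_nz l eq by simp
  have 3: "\<forall>v\<in>hyp r. v$1 = 0 \<longrightarrow> v$3 = 0 \<longrightarrow> l v = 0"
    using linear_mult_Q_eq_F[of 1 3 2 r l c] generic_coords_nz l eq by simp
  have "l v = 0" if v: "v \<in> hyp r" "v$1 = 0" for v
  proof -
    let ?u = "v$2 *s hyp_axis 2"
    have "l ?u = 0" using 3 hyp_axis_in_hyp[of 2] by (simp add: hyp_scale hyp_axis_nth)
    moreover have "l (v - ?u) = 0"
      using 2 v hyp_axis_in_hyp[of 2] by (simp add: hyp_diff hyp_scale hyp_axis_nth)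
    ultimately show ?thesis by (simp add: linear_formD[OF l])
  qed
  then show ?thesis using 2 by blast
qed

text \<open>The presentations on the three walls have a common constant and linear forms that agree
  on overlaps, hence come from a single pair. What is left vanishes on all walls, so it is a
  multiple of x1 x2 x3, and it vanishes at a point of X where that product does not.\<close>

lemma cubic_on_X:
  assumes \<phi>: "trilinear_form \<phi>" and van: "\<And>v. v \<in> Xcone r \<Longrightarrow> \<phi> v v v = 0"
  shows "\<exists>l c. linear_form l \<and> (\<forall>v\<in>hyp r. \<phi> v v v = l v * humQ v + c * humF v)"
proof -
  have sq: "(r$2)^2 + (r$3)^2 \<noteq> 0" "(r$1)^2 + (r$3)^2 \<noteq> 0" "(r$1)^2 + (r$2)^2 \<noteq> 0"
    using gen by (simp_all add: generic_coords_def)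
  obtain l1 c1 where l1: "linear_form l1"
    and e1: "\<And>v. v\<in>hyp r \<Longrightarrow> v$1 = 0 \<Longrightarrow> \<phi> v v v = l1 v * humQ v + c1 * humF v"
    using cubic_on_wall[OF _ _ \<phi> van, of 1 2 3] sq(1) by force
  obtain l2 c2 where l2: "linear_form l2"
    and e2: "\<And>v. v\<in>hyp r \<Longrightarrow> v$2 = 0 \<Longrightarrow> \<phi> v v v = l2 v * humQ v + c2 * humF v"
    using cubic_on_wall[OF _ _ \<phi> van, of 2 1 3] sq(2) by force
  obtain l3 c3 where l3: "linear_form l3"
    and e3: "\<And>v. v\<in>hyp r \<Longrightarrow> v$3 = 0 \<Longrightarrow> \<phi> v v v = l3 v * humQ v + c3 * humF v"
    using cubic_on_wall[OF _ _ \<phi> van, of 3 1 2] sq(3) by force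
  have diff: "linear_form (\<lambda>v. l v - l' v)" if "linear_form l" "linear_form l'" for l l'
    using that unfolding linear_form_def by (simp add: algebra_simps)
  have "c2 - c1 = 0 \<and> (\<forall>v\<in>hyp r. v$1 = 0 \<longrightarrow> v$2 = 0 \<longrightarrow> l1 v - l2 v = 0)"
    using e1 e2 by (intro linear_mult_Q_eq_F[of 1 2 3] diff l1 l2 generic_coords_nz)
      (auto simp: algebra_simps, metis add.commute)
  then have c2: "c2 = c1" and g12: "\<And>v. v\<in>hyp r \<Longrightarrow> v$1 = 0 \<Longrightarrow> v$2 = 0 \<Longrightarrow> l1 v = l2 v" by auto
  have "c3 - c1 = 0 \<and> (\<forall>v\<in>hyp r. v$1 = 0 \<longrightarrow> v$3 = 0 \<longrightarrow> l1 v - l3 v = 0)"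
    using e1 e3 by (intro linear_mult_Q_eq_F[of 1 3 2] diff l1 l3 generic_coords_nz)
      (auto simp: algebra_simps, metis add.commute)
  then have c3: "c3 = c1" and g13: "\<And>v. v\<in>hyp r \<Longrightarrow> v$1 = 0 \<Longrightarrow> v$3 = 0 \<Longrightarrow> l1 v = l3 v" by auto
  have "c3 - c2 = 0 \<and> (\<forall>v\<in>hyp r. v$2 = 0 \<longrightarrow> v$3 = 0 \<longrightarrow> l2 v - l3 v = 0)"
    using e2 e3 by (intro linear_mult_Q_eq_F[of 2 3 1] diff l2 l3 generic_coords_nz)
      (auto simp: algebra_simps, metis add.commute)
  then have g23: "\<And>v. v\<in>hyp r \<Longrightarrow> v$2 = 0 \<Longrightarrow> v$3 = 0 \<Longrightarrow> l2 v = l3 v" by auto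
  define f where "f = hyp_axis 1"
  have f: "f \<in> hyp r" "f$1 = 1" "f$2 = 0" "f$3 = 0"
    using hyp_axis_in_hyp[of 1] by (simp_all add: f_def hyp_axis_nth)
  \<comment> \<open>The vector \<open>f\<close> lies in the second and third walls, where
    \<open>l2\<close> and \<open>l3\<close> agree. So \<open>l\<close> extends \<open>l1\<close>
    from the first wall by the value that both prescribe at \<open>f\<close>.\<close>
  define l where "l v = l1 (v - v$1 *s f) + v$1 * l2 f" for v
  have l: "linear_form l"
    unfolding linear_form_def l_def by (simp add: linear_formD[OF l1] algebra_simps)
  have w1: "l v = l1 v" if "v$1 = 0" for v using that by (simp add: l_def)
  have w2: "l v = l2 v" if "v \<in> hyp r" "v$2 = 0" for v
    using that f g12[of "v - v$1 *s f"] by (simp add: l_def hyp_diff hyp_scale linear_formD[OF l2])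
  have w3: "l v = l3 v" if "v \<in> hyp r" "v$3 = 0" for v
    using that f g13[of "v - v$1 *s f"] g23[of f]
    by (simp add: l_def hyp_diff hyp_scale linear_formD[OF l3])
  define \<psi> where "\<psi> u v w = \<phi> u v w - l u * dot v w
    - c1 * (u$1 * v$2 * w$3 + \<i> * (u$4 * v$5 * w$6))" for u v w :: "complex^6"
  have \<psi>: "trilinear_form \<psi>"
    unfolding \<psi>_def
    by (intro trilinear_form_diff \<phi> trilinear_form_linear_bilinear l bilinear_form_dot trilinear_form_F)
  have \<psi>v: "\<psi> v v v = \<phi> v v v - l v * humQ v - c1 * humF v" for v
    by (simp add: \<psi>_def humQ_dot humF_def)
  have \<psi>0: "\<psi> v v v = 0" if "v \<in> hyp r" "v$1 = 0 \<or> v$2 = 0 \<or> v$3 = 0" for v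
    using that e1 e2 e3 w1 w2 w3 by (auto simp: \<psi>v c2 c3)
  define K where "K = \<psi> (hyp_axis 1) (hyp_axis 2) (hyp_axis 3) + \<psi> (hyp_axis 1) (hyp_axis 3) (hyp_axis 2)
    + \<psi> (hyp_axis 2) (hyp_axis 1) (hyp_axis 3) + \<psi> (hyp_axis 2) (hyp_axis 3) (hyp_axis 1)
    + \<psi> (hyp_axis 3) (hyp_axis 1) (hyp_axis 2) + \<psi> (hyp_axis 3) (hyp_axis 2) (hyp_axis 1)"
  \<comment> \<open>In \<open>v = a + b + c + z\<close> every partial sum missing one of
    \<open>a\<close>, \<open>b\<close>, \<open>c\<close> lies in a wall, so the third difference
    leaves only the polar term.\<close>
  have K: "\<psi> v v v = K * (v$1 * v$2 * v$3)" if v: "v \<in> hyp r" for v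
  proof -
    define a where "a = v$1 *s hyp_axis 1"
    define b where "b = v$2 *s hyp_axis 2"
    define c where "c = v$3 *s hyp_axis 3"
    define z where "z = v - a - b - c"
    have h: "a \<in> hyp r" "b \<in> hyp r" "c \<in> hyp r"
      unfolding a_def b_def c_def by (auto intro!: hyp_scale hyp_axis_in_hyp)
    then have "z \<in> hyp r" unfolding z_def using v by (intro hyp_diff)
    note h = h this
    have co: "a$2 = 0" "a$3 = 0" "b$1 = 0" "b$3 = 0" "c$1 = 0" "c$2 = 0"
      "z$1 = 0" "z$2 = 0" "z$3 = 0"
      by (simp_all add: a_def b_def c_def z_def hyp_axis_nth)
    have "v = a + b + c + z" by (simp add: z_def)
    then have "\<psi> v v v = \<psi> a b c + \<psi> a c b + \<psi> b a c + \<psi> b c a + \<psi> c a b + \<psi> c b a"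
      using trilinear_form_third_difference[OF \<psi>, of a b c z] h co by (simp add: \<psi>0 hyp_add)
    then show ?thesis
      unfolding K_def a_def b_def c_def by (simp add: trilinear_formD[OF \<psi>] algebra_simps)
  qed
  obtain p where p: "p \<in> Xcone r" "p$1 * p$2 * p$3 \<noteq> 0" using point_on_X_off_axes by blast
  have "\<psi> p p p = 0" unfolding \<psi>v using van[OF p(1)] p(1) by (simp add: Xcone_def)
  then have "K = 0" using K[of p] p by (simp add: Xcone_def)
  then have "\<phi> v v v = l v * humQ v + c1 * humF v" if "v \<in> hyp r" for v
    using K[OF that] \<psi>v[of v] by (simp add: \<open>K = 0\<close> algebra_simps)
  then show ?thesis using l by blast
qed

text \<open>Multiplying by x1 gives a cubic through X. Its presentation vanishes on the wall x1 = 0,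
  so \<open>c = 0\<close> and the linear form is a multiple of x1, which can be divided out
  again.\<close>

lemma quadric_on_X:
  assumes b: "bilinear_form b" and van: "\<And>v. v \<in> Xcone r \<Longrightarrow> b v v = 0"
  shows "\<exists>c. \<forall>v\<in>hyp r. b v v = c * humQ v"
proof -
  have x1: "linear_form (\<lambda>v. v$1)" by (simp add: linear_form_def)
  obtain l c where l: "linear_form l"
    and e: "\<And>v. v\<in>hyp r \<Longrightarrow> v$1 * b v v = l v * humQ v + c * humF v"
    using cubic_on_X[OF trilinear_form_linear_bilinear[OF x1 b]] van by auto
  have "- c = 0 \<and> (\<forall>v\<in>hyp r. v$1 = 0 \<longrightarrow> l v = 0)"
  proof (rule linear_mult_Q_eq_F_on_wall[OF l])
    fix v assume "v \<in> hyp r" "v$1 = 0"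
    then show "l v * humQ v = - c * humF v" using e[of v] by (simp add: eq_neg_iff_add_eq_0)
  qed
  then have c: "c = 0" and l0: "\<And>v. v\<in>hyp r \<Longrightarrow> v$1 = 0 \<Longrightarrow> l v = 0" by auto
  define f where "f = hyp_axis 1"
  have f: "f \<in> hyp r" "f$1 = 1"
    using hyp_axis_in_hyp[of 1] by (simp_all add: f_def hyp_axis_nth)
  have l: "l v = v$1 * l f" if "v \<in> hyp r" for v
    using l0[of "v - v$1 *s f"] that f by (simp add: hyp_diff hyp_scale linear_formD[OF l])
  have nz: "b v v = l f * humQ v" if "v \<in> hyp r" "v$1 \<noteq> 0" for v
  proof -
    have "v$1 * b v v = v$1 * (l f * humQ v)" using e[OF that(1)] l[OF that(1)] c by simp
    then show ?thesis using that(2) by simp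
  qed
  \<comment> \<open>Division by x1 fails on the wall. Along the line through \<open>v\<close> in
    direction \<open>f\<close> the difference \<open>g\<close> is quadratic in \<open>t\<close> and
    vanishes for \<open>t\<close> nonzero; the values at 1 and -1 and the leading coefficient
    \<open>g f = 0\<close> yield \<open>g v = 0\<close>.\<close>
  have "b v v = l f * humQ v" if v: "v \<in> hyp r" "v$1 = 0" for v
  proof -
    define g where "g v = b v v - l f * humQ v" for v
    define B where "B = b v f + b f v - l f * (dot v f + dot f v)"
    have ex: "g (v + t *s f) = g v + t * B + t^2 * g f" for t
      unfolding g_def B_def humQ_dot
      by (simp add: bilinear_formD[OF b] bilinear_formD[OF bilinear_form_dot] power2_eq_square algebra_simps)
    have g0: "g (v + t *s f) = 0" if "t \<noteq> 0" for t
      unfolding g_def using nz[of "v + t *s f"] v f that by (simp add: hyp_add hyp_scale)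
    have "g f = 0" using nz[OF f(1)] f(2) by (simp add: g_def)
    then have "g v + B = 0" "g v - B = 0" using ex[of 1] ex[of "-1"] g0[of 1] g0[of "-1"] by simp_all
    then have "2 * g v = 0" by algebra
    then show ?thesis by (simp add: g_def)
  qed
  then show ?thesis using nz by blast
qed

end

section \<open>Harmonic cubic form\<close>

text \<open>The polarization of F without the factor 1/6.\<close>

definition F3 :: "complex^6 \<Rightarrow> complex^6 \<Rightarrow> complex^6 \<Rightarrow> complex" where
  "F3 u v w = u$1 * v$2 * w$3 + u$1 * v$3 * w$2 + u$2 * v$1 * w$3 + u$2 * v$3 * w$1 + u$3 * v$1 * w$2 + u$3 * v$2 * w$1
     + \<i> * (u$4 * v$5 * w$6 + u$4 * v$6 * w$5 + u$5 * v$4 * w$6 + u$5 * v$6 * w$4 + u$6 * v$4 * w$5 + u$6 * v$5 * w$4)"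

text \<open>Orthogonal projection to the hyperplane, multiplied by \<open>dot r r\<close> to be
  polynomial in \<open>r\<close>.\<close>

definition proj :: "complex^6 \<Rightarrow> complex^6 \<Rightarrow> complex^6" where
  "proj r u = dot r r *s u - dot r u *s r"

text \<open>Three times the polarization of the cubic l Q, pulled back along
  \<open>proj\<close>.\<close>

definition cyc :: "complex^6 \<Rightarrow> (complex^6 \<Rightarrow> complex) \<Rightarrow> complex^6 \<Rightarrow> complex^6 \<Rightarrow> complex^6 \<Rightarrow> complex" where
  "cyc r l u v w = l (proj r u) * dot (proj r v) (proj r w) + l (proj r v) * dot (proj r u) (proj r w)
     + l (proj r w) * dot (proj r u) (proj r v)"

text \<open>A multiple of the polarized harmonic projection of the restriction of \<open>F\<close> to the hyperplane,
  extended to the whole space along \<open>r\<close>; the normalization avoids denominators.\<close>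
definition harm :: "complex^6 \<Rightarrow> complex^6 \<Rightarrow> complex^6 \<Rightarrow> complex^6 \<Rightarrow> complex" where
  "harm r u v w = 7 * dot r r * F3 (proj r u) (proj r v) (proj r w) + cyc r (\<lambda>x. F3 x r r) u v w"

definition slice :: "complex^6 \<Rightarrow> complex^6 \<Rightarrow> complex^6^6" where
  "slice r u = (\<chi> i j. harm r u (axis i 1) (axis j 1))"

definition Tmat :: "complex^6 \<Rightarrow> complex^6^6" where
  "Tmat r = (\<chi> a b. trace (transpose (slice r (axis a 1)) ** slice r (axis b 1)))"

definition wvec :: "complex^6 \<Rightarrow> complex^6" where
  "wvec r = (\<chi> a. trace (slice r (axis a 1) ** Tmat r))"

text \<open>The row \<open>r\<close> accounts for the normal direction, so nonvanishing of the
  determinant means that a vector orthogonal to all six rows is zero.\<close>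

definition krylov :: "complex^6 \<Rightarrow> complex^6^6" where
  "krylov r = (let T = Tmat r; w = wvec r in
     vector [r, w, T *v w, T *v (T *v w), T *v (T *v (T *v w)), T *v (T *v (T *v (T *v w)))])"

lemma trace_cyclic: "trace (A ** B) = trace (B ** (A :: complex^6^6))"
  by (rule trace_mul_sym)

lemma trace_scaleM: "trace (mat c ** A) = c * trace (A :: complex^6^6)"
proof -
  have "(mat c ** A) $ i $ i = c * A $ i $ i" for i
    by (simp add: matrix_matrix_mult_def mat_def if_distrib[of "\<lambda>x. x * _"] cong: if_cong)
  then show ?thesis unfolding trace_def by (simp only: sum_distrib_left)
qed

lemma mat_commute: "mat c ** A = A ** mat (c :: complex) " for A :: "complex^6^6"
  by (simp add: matrix_matrix_mult_def mat_def vec_eq_iff if_distrib[of "\<lambda>x. x * _"] if_distrib[of "\<lambda>x. _ * x"] cong: if_cong)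

lemma linear_form_axis:
  assumes "linear_form f"
  shows "f v = (\<Sum>i\<in>UNIV. v$i * f (axis i 1))"
proof -
  have "f (\<Sum>i\<in>A. v$i *s axis i 1) = (\<Sum>i\<in>A. v$i * f (axis i 1))" for A :: "6 set"
    by (induction A rule: infinite_finite_induct) (simp_all add: linear_formD[OF assms])
  from this[of UNIV] show ?thesis by (simp only: basis_expansion)
qed

lemma bilinear_form_transform:
  fixes A B :: "complex^6^6"
  assumes X: "bilinear_form X"
  shows "transpose A ** (\<chi> i j. X (axis i 1) (axis j 1)) ** B = (\<chi> i j. X (A *v axis i 1) (B *v axis j 1))"
proof -
  have l: "linear_form (\<lambda>u. X u v)" "linear_form (X v)" for v
    using X by (simp_all add: bilinear_form_def)
  have X': "X u v = (\<Sum>a\<in>UNIV. u$a * (\<Sum>b\<in>UNIV. v$b * X (axis a 1) (axis b 1)))" for u v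
    by (subst linear_form_axis[OF l(1), of u], subst linear_form_axis[OF l(2), of _ v]) simp
  have col: "(C *v axis i 1) $ a = C$a$i" for C :: "complex^6^6" and i a
    by (simp add: matrix_vector_mult_def axis_def if_distrib[of "\<lambda>x. _ * x"] cong: if_cong)
  have "(\<Sum>b\<in>UNIV. (\<Sum>a\<in>UNIV. A$a$i * X (axis a 1) (axis b 1)) * B$b$j)
      = X (A *v axis i 1) (B *v axis j 1)" for i j
    unfolding X'[of "A *v axis i 1" "B *v axis j 1"]
    by (simp add: col sum_distrib_left sum_distrib_right mult_ac) (subst sum.swap, simp add: mult_ac)
  then show ?thesis
    by (simp add: vec_eq_iff matrix_matrix_mult_def transpose_def)
qed

lemma trilinear_form_F3: "trilinear_form F3"
  unfolding trilinear_form_def linear_form_def F3_def vector_add_component vector_smult_component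
  by (intro conjI allI; algebra)

lemma linear_form_gamma: "linear_form (\<lambda>x. F3 x r r)"
  unfolding linear_form_def by (simp add: trilinear_formD[OF trilinear_form_F3])

lemma proj_linear: "proj r (u + v) = proj r u + proj r v" "proj r (c *s u) = c *s proj r u"
  unfolding proj_def by (simp_all add: bilinear_formD[OF bilinear_form_dot] vec_eq_iff algebra_simps)

lemma linear_form_dot: "linear_form (dot r)"
  using bilinear_form_dot by (simp add: bilinear_form_def)

lemma proj_in_hyp: "proj r u \<in> hyp r"
  by (simp add: hyp_iff_dot proj_def linear_formD[OF linear_form_dot])

lemma dot_commute: "dot u v = dot v u"
  by (simp add: dot_def mult.commute)

lemma trilinear_form_cyc: "linear_form l \<Longrightarrow> trilinear_form (cyc r l)"
  unfolding trilinear_form_def linear_form_def cyc_def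
  by (simp add: proj_linear bilinear_formD[OF bilinear_form_dot] algebra_simps)

lemma trilinear_form_F3_proj: "trilinear_form (\<lambda>u v w. F3 (proj r u) (proj r v) (proj r w))"
  unfolding trilinear_form_def linear_form_def
  by (simp add: proj_linear trilinear_formD[OF trilinear_form_F3])

lemma trilinear_form_harm: "trilinear_form (harm r)"
  unfolding trilinear_form_def linear_form_def harm_def
  by (simp add: trilinear_formD[OF trilinear_form_F3_proj] algebra_simps
      trilinear_formD[OF trilinear_form_cyc[OF linear_form_gamma]])

lemma trilinear_form_fix: "trilinear_form \<phi> \<Longrightarrow> bilinear_form (\<phi> u)"
  by (simp add: trilinear_form_def bilinear_form_def)

text \<open>With S = \<open>dot r r\<close>, the matrix of \<open>proj\<close> is S I - r r^T, and
  its square is S^2 I - S r r^T.\<close>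

lemma contraction_proj:
  assumes X: "bilinear_form X"
  shows "(\<Sum>i\<in>UNIV. X (proj r (axis i 1)) (proj r (axis i 1))) =
    (dot r r)^2 * (\<Sum>i\<in>UNIV. X (axis i 1) (axis i 1)) - dot r r * X r r"
proof -
  define S where "S = dot r r"
  have l: "linear_form (\<lambda>u. X u v)" "linear_form (X v)" for v
    using X by (simp_all add: bilinear_form_def)
  have p: "proj r (axis i 1) = S *s axis i 1 + (- r$i) *s r" for i
  proof -
    have "dot r (axis i 1) = r$i" by (simp add: dot_def axis_def if_distrib[of "\<lambda>x. _ * x"] cong: if_cong)
    then show ?thesis by (simp add: proj_def S_def vec_eq_iff)
  qed
  have "X (proj r (axis i 1)) (proj r (axis i 1)) = S^2 * X (axis i 1) (axis i 1)
      - S * (r$i * X (axis i 1) r) - S * (r$i * X r (axis i 1)) + r$i * r$i * X r r" for i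
    unfolding p bilinear_formD[OF X] by (simp add: algebra_simps power2_eq_square)
  then have "(\<Sum>i\<in>UNIV. X (proj r (axis i 1)) (proj r (axis i 1))) = S^2 * (\<Sum>i\<in>UNIV. X (axis i 1) (axis i 1))
      - S * (\<Sum>i\<in>UNIV. r$i * X (axis i 1) r) - S * (\<Sum>i\<in>UNIV. r$i * X r (axis i 1)) + (\<Sum>i\<in>UNIV. r$i * r$i) * X r r"
    by (simp add: sum.distrib sum_subtractf sum_distrib_left sum_distrib_right)
  also have "(\<Sum>i\<in>UNIV. r$i * X (axis i 1) r) = X r r" using linear_form_axis[OF l(1), of r r] by simp
  also have "(\<Sum>i\<in>UNIV. r$i * X r (axis i 1)) = X r r" using linear_form_axis[OF l(2), of r r] by simp
  also have "(\<Sum>i\<in>UNIV. r$i * r$i) = S" by (simp add: S_def dot_def)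
  finally show ?thesis by (simp add: S_def)
qed

text \<open>The 7 is 5 + 1 + 1: the dimension of the hyperplane from the term where the contracted
  pair sits in \<open>dot\<close>, and one from each of the two mixed terms. Since it is nonzero, a
  multiple of Q without trace vanishes when \<open>dot r r\<close> is nonzero.\<close>

lemma contraction_cyc:
  assumes l: "linear_form l"
  shows "(\<Sum>i\<in>UNIV. cyc r l u (axis i 1) (axis i 1)) = 7 * (dot r r)^2 * l (proj r u)"
proof -
  let ?S = "dot r r" and ?x = "proj r u"
  have 1: "(\<Sum>i\<in>UNIV. dot (proj r (axis i 1)) (proj r (axis i 1))) = 5 * ?S^2"
    by (subst contraction_proj[OF bilinear_form_dot]) (simp add: dot_def axis_def sum_6 power2_eq_square)
  have b: "bilinear_form (\<lambda>v w. l v * dot ?x w)"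
    unfolding bilinear_form_def linear_form_def
    by (simp add: linear_formD[OF l] bilinear_formD[OF bilinear_form_dot] algebra_simps)
  have "dot ?x (axis i 1) = ?x$i" for i
    by (simp add: dot_def axis_def if_distrib[of "\<lambda>x. _ * x"] cong: if_cong)
  then have "(\<Sum>i\<in>UNIV. l (axis i 1) * dot ?x (axis i 1)) = l ?x"
    using linear_form_axis[OF l, of ?x] by (simp add: mult.commute)
  then have 2: "(\<Sum>i\<in>UNIV. l (proj r (axis i 1)) * dot ?x (proj r (axis i 1))) = ?S^2 * l ?x"
    using contraction_proj[OF b, of r] proj_in_hyp[of r u] by (simp add: hyp_iff_dot dot_commute[of ?x r])
  have "(\<Sum>i\<in>UNIV. cyc r l u (axis i 1) (axis i 1)) = l ?x * (5 * ?S^2) + ?S^2 * l ?x + ?S^2 * l ?x"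
    unfolding cyc_def sum.distrib 2 sum_distrib_left[symmetric] 1 ..
  then show ?thesis by simp
qed

text \<open>All monomials of F are squarefree, so F is harmonic on the whole space and its trace on
  the hyperplane is minus the contribution of the normal \<open>r\<close>. The correction by
  \<open>F3 x r r\<close>, with the weight 7 of the contraction, cancels exactly this.\<close>

lemma trace_slice: "trace (slice r u) = 0"
proof -
  have "(\<Sum>i\<in>UNIV. F3 x (axis i 1) (axis i 1)) = 0" for x
    by (simp add: sum_6 F3_def axis_def)
  then have "(\<Sum>i\<in>UNIV. F3 (proj r u) (proj r (axis i 1)) (proj r (axis i 1)))
      = - (dot r r * F3 (proj r u) r r)"
    by (simp add: contraction_proj[OF trilinear_form_fix[OF trilinear_form_F3]])
  then show ?thesis
    unfolding trace_def slice_def harm_def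
    by (simp add: sum.distrib contraction_cyc[OF linear_form_gamma] sum_distrib_left[symmetric] power2_eq_square)
qed

lemma symmetric_trilinear_polarization:
  assumes \<phi>: "trilinear_form \<phi>"
    and sym: "\<And>u v w. \<phi> u v w = \<phi> v u w" "\<And>u v w. \<phi> u v w = \<phi> u w v"
    and diag: "\<And>v. v \<in> hyp r \<Longrightarrow> \<phi> v v v = 0" and uvw: "u \<in> hyp r" "v \<in> hyp r" "w \<in> hyp r"
  shows "\<phi> u v w = 0"
proof -
  have h: "x + y \<in> hyp r" if "x \<in> hyp r" "y \<in> hyp r" for x y
    using that by (simp add: hyp_iff_dot bilinear_formD[OF bilinear_form_dot])
  have "0 \<in> hyp r" by (simp add: hyp_def)
  then have "\<phi> u v w + \<phi> u w v + \<phi> v u w + \<phi> v w u + \<phi> w u v + \<phi> w v u = 0"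
    using trilinear_form_third_difference[OF \<phi>, of u v w 0] uvw by (simp add: diag h)
  moreover have "\<phi> u w v = \<phi> u v w" "\<phi> v u w = \<phi> u v w" "\<phi> v w u = \<phi> u v w" "\<phi> w u v = \<phi> u v w" "\<phi> w v u = \<phi> u v w"
    using sym by metis+
  ultimately show ?thesis by simp
qed

section \<open>Covariants under similitudes\<close>

lemma mat_mult_nth: "(mat c ** X) $ i $ j = c * X $ i $ j" for X :: "complex^6^6"
  by (simp add: matrix_matrix_mult_def mat_def if_distrib[of "\<lambda>x. x * _"] cong: if_cong)

lemma mat_left: "X ** (mat c ** Y) = mat c ** (X ** Y)" for X Y :: "complex^6^6"
  by (metis mat_commute matrix_mul_assoc)

lemma transpose_conj_trace:
  fixes A X :: "complex^6^6"
  assumes "A ** transpose A = mat \<mu>"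
  shows "trace (transpose A ** X ** A) = \<mu> * trace X"
proof -
  have "trace (transpose A ** X ** A) = trace (X ** (A ** transpose A))"
    using trace_cyclic[of "transpose A" "X ** A"] by (simp add: matrix_mul_assoc)
  then show ?thesis by (metis assms mat_commute trace_scaleM)
qed

lemma dot_axis: "dot (axis i 1) (axis j 1) = (if i = j then 1 else 0)"
  by (simp add: dot_def axis_def if_distrib[of "\<lambda>x. x * _"] cong: if_cong)

text \<open>The hypothesis describes \<open>transpose A ** A\<close>; contractions need the product
  in the other order, which agrees because a left inverse of a square matrix is also a right
  inverse.\<close>

lemma similitude_transpose:
  assumes orth: "\<And>u v. dot (A *v u) (A *v v) = \<mu> * dot u v" and \<mu>: "\<mu> \<noteq> 0"
  shows "A ** transpose A = mat \<mu>"
proof -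
  have "(\<chi> i j. dot (axis i 1) (axis j 1)) = (mat 1 :: complex^6^6)"
    by (simp add: dot_axis mat_def)
  moreover have "(\<chi> i j. dot (A *v axis i 1) (A *v axis j 1)) = mat \<mu>"
    by (simp add: orth dot_axis mat_def vec_eq_iff)
  ultimately have "transpose A ** A = mat \<mu>"
    using bilinear_form_transform[OF bilinear_form_dot, of A A] by simp
  moreover have inv: "mat (1/\<mu>) ** mat \<mu> = (mat 1 :: complex^6^6)"
    using \<mu> by (simp add: matrix_matrix_mult_def mat_def vec_eq_iff if_distrib[of "\<lambda>x. x * _"] cong: if_cong)
  ultimately have "mat (1/\<mu>) ** transpose A ** A = mat 1" by (metis matrix_mul_assoc)
  then have "A ** (mat (1/\<mu>) ** transpose A) = mat 1" using matrix_left_right_inverse by blast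
  then have "mat (1/\<mu>) ** (A ** transpose A) = mat 1" by (metis matrix_mul_assoc mat_commute)
  then show ?thesis
    by (metis inv mat_commute matrix_mul_assoc matrix_mul_lid matrix_mul_rid)
qed

text \<open>Both sides of the invariance are harmonic and they differ by a multiple of \<open>Q\<close>, which
  the contraction detects.\<close>
lemma harm_invariant:
  assumes S: "dot r r \<noteq> 0" and m: "m \<noteq> 0" and Ar: "A *v r = m *s r"
    and orth: "\<And>u v. dot (A *v u) (A *v v) = m^2 * dot u v"
    and l: "linear_form l"
    and F: "\<And>x y z. x \<in> hyp r \<Longrightarrow> y \<in> hyp r \<Longrightarrow> z \<in> hyp r \<Longrightarrow> F3 (A *v x) (A *v y) (A *v z) =
      d * F3 x y z + 2 * (l x * dot y z + l y * dot x z + l z * dot x y)"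
  shows "harm r (A *v u) (A *v v) (A *v w) = d * harm r u v w"
proof -
  have AA: "A ** transpose A = mat (m^2)" using similitude_transpose[OF orth] m by simp
  have "m * dot r (A *v u) = m * (m * dot r u)" for u
    using orth[of r u] unfolding Ar by (simp add: bilinear_formD[OF bilinear_form_dot] power2_eq_square)
  then have rA: "dot r (A *v u) = m * dot r u" for u using m by simp
  have pA: "proj r (A *v u) = A *v proj r u" for u
    unfolding proj_def rA by (simp add: matrix_vector_mult_diff_distrib matrix_vector_mult_scaleR
      vector_scalar_commute Ar)
  \<comment> \<open>\<open>cyc r g\<close> is the defect of invariance. The 14 is the 7 of
    \<open>harm\<close> times the 2 in \<open>F\<close>, and \<open>m^2\<close> comes from
    \<open>dot\<close> evaluated at images under \<open>A\<close>.\<close>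
  define g where "g x = 14 * dot r r * l x + m^2 * F3 (A *v x) r r - d * F3 x r r" for x
  have lin: "linear_form g"
    unfolding linear_form_def g_def
    by (simp add: linear_formD[OF l] trilinear_formD[OF trilinear_form_F3] matrix_vector_right_distrib
        vector_scalar_commute algebra_simps)
  have c: "harm r (A *v u) (A *v v) (A *v w) - d * harm r u v w = cyc r g u v w" for u v w
    unfolding harm_def cyc_def pA orth F[OF proj_in_hyp proj_in_hyp proj_in_hyp] g_def by algebra
  have "g (proj r u) = 0" for u
  proof -
    \<comment> \<open>Contracting over the vectors \<open>A *v axis i 1\<close> multiplies a trace
      by \<open>m^2\<close>, so the transformed form is trace free as well.\<close>
    have "(\<Sum>i\<in>UNIV. harm r (A *v u) (A *v axis i 1) (A *v axis i 1)) = trace (transpose A ** slice r (A *v u) ** A)"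
      using bilinear_form_transform[OF trilinear_form_fix[OF trilinear_form_harm], of A r "A *v u" A]
      by (simp add: slice_def trace_def)
    also have "\<dots> = 0" by (simp add: transpose_conj_trace[OF AA] trace_slice)
    finally have "(\<Sum>i\<in>UNIV. cyc r g u (axis i 1) (axis i 1)) = 0"
      using trace_slice[of r u]
      by (simp add: c[symmetric] sum_subtractf sum_distrib_left[symmetric] trace_def slice_def)
    then show ?thesis using S by (simp add: contraction_cyc[OF lin])
  qed
  then show ?thesis using c[of u v w] by (simp add: cyc_def)
qed

lemma slice_add: "slice r (u + v) = slice r u + slice r v" "slice r (c *s u) = mat c ** slice r u"
  by (simp_all add: slice_def vec_eq_iff trilinear_formD[OF trilinear_form_harm]
      matrix_matrix_mult_def mat_def if_distrib[of "\<lambda>x. x * _"] cong: if_cong)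

lemma bilinear_form_slice_trace:
  "bilinear_form (\<lambda>u v. trace (transpose (slice r u) ** slice r v))"
  unfolding bilinear_form_def linear_form_def
  by (simp add: slice_add trace_def matrix_matrix_mult_def transpose_def mat_def sum.distrib sum_distrib_left
     algebra_simps if_distrib[of "\<lambda>x. x * _"] if_distrib[of "\<lambda>x. _ * x"] cong: if_cong)

lemma linear_form_wvec: "linear_form (\<lambda>u. trace (slice r u ** B))"
proof -
  have "(X + Y) ** B = X ** B + Y ** B" for X Y :: "complex^6^6"
    by (simp add: matrix_matrix_mult_def vec_eq_iff sum.distrib distrib_right)
  then show ?thesis
    unfolding linear_form_def by (simp add: slice_add trace_add trace_scaleM flip: matrix_mul_assoc)
qed

lemma transpose_Tmat: "transpose (Tmat r) = Tmat r"
proof -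
  have "trace (transpose X ** Y) = trace (transpose Y ** X)" for X Y :: "complex^6^6"
    by (simp add: trace_def matrix_matrix_mult_def transpose_def mult.commute)
  then show ?thesis by (simp add: Tmat_def transpose_def vec_eq_iff)
qed

lemma dot_transpose: "dot x (A *v v) = dot (transpose A *v x) v"
  by (simp add: dot_def matrix_vector_mult_def transpose_def sum_distrib_left sum_distrib_right mult_ac)
    (subst sum.swap, simp)

text \<open>The invariance gives \<open>transpose A ** T ** A\<close> as \<open>d^2/\<mu>^2\<close>
  times \<open>T\<close>. Comparing traces through \<open>A ** transpose A = mat \<mu>\<close>
  forces \<open>d^2 = \<mu>^3\<close>, and the relation turns into commutation of \<open>A\<close>
  with \<open>T\<close>. Then \<open>w\<close> satisfies
  \<open>dot w (A *v u) = \<omega> * dot w u\<close>, a property that \<open>T\<close>, being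
  symmetric and commuting with \<open>A\<close>, passes on along its orbit.\<close>

lemma similitude_scalar:
  assumes S: "dot r r \<noteq> 0" and m: "m \<noteq> 0" and Ar: "A *v r = m *s r"
    and orth: "\<And>u v. dot (A *v u) (A *v v) = m^2 * dot u v"
    and inv: "\<And>u v w. harm r (A *v u) (A *v v) (A *v w) = d * harm r u v w"
    and T0: "trace (Tmat r) \<noteq> 0" and K0: "det (krylov r) \<noteq> 0"
  shows "\<exists>c. \<forall>v\<in>hyp r. A *v v = c *s v"
proof -
  define T w \<mu> \<omega> where Tw: "T = Tmat r" "w = wvec r" "\<mu> = m^2" "\<omega> = d / \<mu>"
  have \<mu>: "\<mu> \<noteq> 0" using m by (simp add: Tw)
  have AA: "A ** transpose A = mat \<mu>" using similitude_transpose[OF orth] m by (simp add: Tw)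
  have sl: "transpose A ** slice r (A *v u) ** A = mat d ** slice r u" for u
    using bilinear_form_transform[OF trilinear_form_fix[OF trilinear_form_harm], of A r "A *v u" A]
    by (simp add: slice_def inv vec_eq_iff matrix_matrix_mult_def mat_def if_distrib[of "\<lambda>x. x * _"] cong: if_cong)
  let ?\<tau> = "\<lambda>u v. trace (transpose (slice r u) ** slice r v)"
  have tau: "\<mu>^2 * ?\<tau> (A *v u) (A *v v) = d^2 * ?\<tau> u v" for u v
  proof -
    let ?X = "slice r (A *v u)" and ?Y = "slice r (A *v v)"
    have "transpose (transpose A ** ?X ** A) ** (transpose A ** ?Y ** A)
       = transpose A ** transpose ?X ** (A ** transpose A) ** ?Y ** A"
      by (simp add: matrix_transpose_mul matrix_mul_assoc)
    also have "\<dots> = transpose A ** (mat \<mu> ** (transpose ?X ** ?Y)) ** A"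
      unfolding AA matrix_mul_assoc[symmetric] mat_left ..
    finally have "trace (transpose (transpose A ** ?X ** A) ** (transpose A ** ?Y ** A))
        = \<mu> * (\<mu> * ?\<tau> (A *v u) (A *v v))"
      by (simp add: transpose_conj_trace[OF AA] trace_scaleM)
    moreover have "transpose (mat d ** slice r u) ** (mat d ** slice r v)
      = mat d ** (mat d ** (transpose (slice r u) ** slice r v))"
      by (metis mat_commute matrix_mul_assoc matrix_transpose_mul transpose_mat)
    ultimately show ?thesis unfolding sl by (simp add: trace_scaleM power2_eq_square mult.assoc)
  qed
  have T: "T = (\<chi> i j. ?\<tau> (axis i 1) (axis j 1))" by (simp add: Tw Tmat_def)
  have "transpose A ** T ** A = (\<chi> i j. ?\<tau> (A *v axis i 1) (A *v axis j 1))"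
    unfolding T using bilinear_form_transform[OF bilinear_form_slice_trace, of A r A] .
  also have "\<dots> = mat (d^2/\<mu>^2) ** T"
  proof -
    have "?\<tau> (A *v u) (A *v v) = (d^2/\<mu>^2) * ?\<tau> u v" for u v
      using tau[of u v] \<mu> by (simp add: field_simps)
    then show ?thesis unfolding vec_eq_iff mat_mult_nth unfolding T by simp
  qed
  finally have ATA': "transpose A ** T ** A = mat (d^2/\<mu>^2) ** T" .
  then have "\<mu> * trace T = (d^2/\<mu>^2) * trace T"
    using transpose_conj_trace[OF AA, of T] by (simp only: trace_scaleM)
  moreover have "trace T \<noteq> 0" using T0 by (simp add: Tw)
  ultimately have "d^2/\<mu>^2 = \<mu>" by (metis mult_right_cancel)
  then have ATA: "transpose A ** T ** A = mat \<mu> ** T" using ATA' by simp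
  have "transpose A ** T ** mat \<mu> = mat \<mu> ** T ** transpose A"
    by (metis AA ATA matrix_mul_assoc)
  then have "mat \<mu> ** (transpose A ** T) = mat \<mu> ** (T ** transpose A)"
    by (metis mat_commute matrix_mul_assoc)
  moreover have minv: "mat (1/\<mu>) ** (mat \<mu> ** B) = B" for B :: "complex^6^6"
    using \<mu> by (simp add: matrix_matrix_mult_def mat_def vec_eq_iff if_distrib[of "\<lambda>x. x * _"] cong: if_cong)
  ultimately have com: "transpose A ** T = T ** transpose A" by metis
  then have com': "T ** A = A ** T"
    using transpose_Tmat[of r] by (metis Tw(1) matrix_transpose_mul transpose_transpose)
  have "\<mu> * dot w (A *v u) = d * dot w u" for u
  proof -
    have dw: "dot w x = trace (slice r x ** T)" for x
      using linear_form_axis[OF linear_form_wvec[where r = r and B = T], of x] by (simp add: Tw wvec_def dot_def mult.commute)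
    have "d * dot w u = trace (transpose A ** slice r (A *v u) ** A ** T)"
      unfolding sl dw by (simp add: trace_scaleM flip: matrix_mul_assoc)
    also have "\<dots> = trace (transpose A ** (slice r (A *v u) ** T) ** A)"
      by (metis com' matrix_mul_assoc)
    finally show ?thesis by (simp add: transpose_conj_trace[OF AA] dw)
  qed
  then have w: "dot w (A *v u) = \<omega> * dot w u" for u
    using \<mu> by (simp add: Tw(4) field_simps)
  have step: "\<forall>u. dot (T *v x) (A *v u) = \<omega> * dot (T *v x) u" if x: "\<forall>u. dot x (A *v u) = \<omega> * dot x u" for x
  proof
    fix u
    have sym: "dot (T *v x) v = dot x (T *v v)" for v
      using dot_transpose[of x T v] transpose_Tmat[of r] by (simp add: Tw(1))
    show "dot (T *v x) (A *v u) = \<omega> * dot (T *v x) u"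
      unfolding sym using x by (metis com' matrix_vector_mul_assoc)
  qed
  have "m * dot r (A *v u) = m * (m * dot r u)" for u
    using orth[of r u] unfolding Ar by (simp add: bilinear_formD[OF bilinear_form_dot] power2_eq_square)
  then have rA: "dot r (A *v u) = m * dot r u" for u using m by simp
  have "A *v v = \<omega> *s v" if v: "v \<in> hyp r" for v
  proof -
    \<comment> \<open>Both \<open>v\<close> and \<open>A *v v\<close> are orthogonal to
      \<open>r\<close>, so \<open>z\<close> is orthogonal to every row of
      \<open>krylov r\<close>.\<close>
    define z where "z = A *v v - \<omega> *s v"
    have zw: "dot x z = 0" if "\<forall>u. dot x (A *v u) = \<omega> * dot x u" for x
      using that unfolding z_def by (simp add: linear_formD[OF linear_form_dot])
    have zr: "dot r z = 0" using v unfolding z_def by (simp add: rA linear_formD[OF linear_form_dot] hyp_iff_dot)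
    have kd: "(krylov r *v z) $ i = dot (krylov r $ i) z" for i
      by (simp add: matrix_vector_mult_def dot_def)
    have "krylov r *v z = 0"
      unfolding vec_eq_iff forall_6 kd unfolding krylov_def Let_def vector_6 Tw(1,2)[symmetric] zero_index
      by (intro conjI zr zw step allI w)
    moreover have "invertible (krylov r)" using K0 by (simp add: invertible_det_nz)
    ultimately have "z = 0"
      by (metis invertible_def matrix_vector_mul_assoc matrix_vector_mul_lid matrix_vector_mult_0_right)
    then show ?thesis by (simp add: z_def)
  qed
  then show ?thesis by blast
qed

section \<open>Automorphisms\<close>

lemma quadric_not_zero_on_hyp:
  assumes "(r$2)^2 + (r$3)^2 \<noteq> 0"
  shows "\<exists>v\<in>hyp r. humQ v \<noteq> 0"
proof -
  define v :: "complex^6" where "v = vector [0, r$3, - r$2, 0, 0, 0]"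
  note v = vector_6[of 0 "r$3" "- r$2" 0 0 0, folded v_def]
  have "v \<in> hyp r" by (simp add: hyp_iff_dot dot_6 v)
  moreover have "humQ v = (r$2)^2 + (r$3)^2" by (simp add: humQ_def v)
  ultimately show ?thesis using assms by metis
qed

lemma bilinear_form_pullback: "bilinear_form b \<Longrightarrow> bilinear_form (\<lambda>u v. b ((M :: complex^6^6) *v u) (M *v v))"
  unfolding bilinear_form_def linear_form_def by (simp add: matrix_vector_right_distrib vector_scalar_commute)

lemma trilinear_form_pullback:
  "trilinear_form \<phi> \<Longrightarrow> trilinear_form (\<lambda>u v w. \<phi> ((M :: complex^6^6) *v u) (M *v v) (M *v w))"
  unfolding trilinear_form_def linear_form_def by (simp add: matrix_vector_right_distrib vector_scalar_commute)

lemma trilinear_form_scale: "trilinear_form \<phi> \<Longrightarrow> trilinear_form (\<lambda>u v w. c * \<phi> u v w)"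
  unfolding trilinear_form_def linear_form_def by (simp add: algebra_simps)

lemma trilinear_form_add:
  assumes "trilinear_form \<phi>" "trilinear_form \<psi>"
  shows "trilinear_form (\<lambda>u v w. \<phi> u v w + \<psi> u v w)"
  unfolding trilinear_form_def linear_form_def
  by (simp add: trilinear_formD[OF assms(1)] trilinear_formD[OF assms(2)] algebra_simps)

lemma trilinear_form_swap:
  assumes "trilinear_form \<phi>"
  shows "trilinear_form (\<lambda>u v w. \<phi> v u w)" "trilinear_form (\<lambda>u v w. \<phi> w u v)"
  using assms unfolding trilinear_form_def by blast+

lemma F3_swap: "F3 u v w = F3 v u w" "F3 u v w = F3 u w v"
  unfolding F3_def by (simp_all add: algebra_simps)

lemma F3_diag: "F3 v v v = 6 * humF v"
  unfolding F3_def humF_def by (simp add: algebra_simps)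

text \<open>The matrix \<open>M\<close> is controlled only on the hyperplane. It is replaced by a
  similitude of the whole space with the same restriction, so that traces of six by six matrices
  apply.\<close>

lemma automorphism_trivial:
  assumes gen: "generic_coords r" and S: "dot r r \<noteq> 0"
    and T0: "trace (Tmat r) \<noteq> 0" and K0: "det (krylov r) \<noteq> 0" and M: "preserves_X r M"
  shows "trivial_on_R r M"
proof -
  have Mh: "M *v v \<in> hyp r" if "v \<in> hyp r" for v using M that unfolding preserves_X_def by blast
  have MX: "M *v v \<in> Xcone r" if "v \<in> Xcone r" for v using M that unfolding preserves_X_def by blast
  have hadd: "x + y \<in> hyp r" if "x \<in> hyp r" "y \<in> hyp r" for x y
    using that by (simp add: hyp_iff_dot linear_formD[OF linear_form_dot])
  have "\<And>v. v \<in> Xcone r \<Longrightarrow> dot (M *v v) (M *v v) = 0"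
    using MX by (simp add: Xcone_def humQ_dot)
  then obtain \<mu> where \<mu>: "\<And>v. v \<in> hyp r \<Longrightarrow> dot (M *v v) (M *v v) = \<mu> * humQ v"
    using quadric_on_X[OF gen bilinear_form_pullback[OF bilinear_form_dot], of M] by blast
  have \<mu>0: "\<mu> \<noteq> 0"
  proof
    assume 0: "\<mu> = 0"
    obtain v where v: "v \<in> hyp r" "humQ v \<noteq> 0"
      using quadric_not_zero_on_hyp[of r] gen unfolding generic_coords_def by blast
    have "v \<in> (*v) M ` hyp r" using M v unfolding preserves_X_def by blast
    then obtain u where "u \<in> hyp r" "v = M *v u" by blast
    then show False using \<mu>[of u] v 0 by (simp add: humQ_dot)
  qed
  have orthM: "dot (M *v u) (M *v v) = \<mu> * dot u v" if "u \<in> hyp r" "v \<in> hyp r" for u v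
  proof -
    have "2 * dot (M *v u) (M *v v) = 2 * (\<mu> * dot u v)"
      using \<mu>[OF hadd[OF that]] \<mu>[OF that(1)] \<mu>[OF that(2)]
        dot_commute[of "M *v v" "M *v u"] dot_commute[of v u]
      by (simp add: humQ_dot matrix_vector_right_distrib bilinear_formD[OF bilinear_form_dot] algebra_simps)
    then show ?thesis by simp
  qed
  define \<phi> where "\<phi> u v w = 1 * ((M *v u)$1 * (M *v v)$2 * (M *v w)$3
      + \<i> * ((M *v u)$4 * (M *v v)$5 * (M *v w)$6))" for u v w
  have \<phi>: "trilinear_form \<phi>"
    unfolding \<phi>_def by (rule trilinear_form_pullback[OF trilinear_form_F])
  have \<phi>v: "\<phi> v v v = humF (M *v v)" for v by (simp add: \<phi>_def humF_def)
  have "\<And>v. v \<in> Xcone r \<Longrightarrow> \<phi> v v v = 0" using MX by (simp add: \<phi>v Xcone_def)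
  then obtain l d where l: "linear_form l"
    and F: "\<And>v. v \<in> hyp r \<Longrightarrow> humF (M *v v) = l v * humQ v + d * humF v"
    using cubic_on_X[OF gen \<phi>] unfolding \<phi>v by blast
  \<comment> \<open>The factor 2 is 6/3: on the diagonal \<open>F3\<close> is six times F, while the
    cyclic sum is three times l Q.\<close>
  have F3M: "F3 (M *v x) (M *v y) (M *v z) = d * F3 x y z + 2 * (l x * dot y z + l y * dot x z + l z * dot x y)"
    if "x \<in> hyp r" "y \<in> hyp r" "z \<in> hyp r" for x y z
  proof -
    define \<psi> where "\<psi> x y z = F3 (M *v x) (M *v y) (M *v z) - (d * F3 x y z
      + 2 * (l x * dot y z + l y * dot x z + l z * dot x y))" for x y z
    have tl: "trilinear_form (\<lambda>u v w. l u * dot v w)"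
      by (rule trilinear_form_linear_bilinear[OF l bilinear_form_dot])
    have "trilinear_form \<psi>"
      unfolding \<psi>_def
      by (intro trilinear_form_diff trilinear_form_add trilinear_form_scale tl
          trilinear_form_swap[OF tl] trilinear_form_pullback trilinear_form_F3)
    moreover have "\<psi> x y z = \<psi> y x z" for x y z
      unfolding \<psi>_def using F3_swap(1)[of x y z] F3_swap(1)[of "M *v x" "M *v y" "M *v z"] dot_commute[of x y]
      by simp
    moreover have "\<psi> x y z = \<psi> x z y" for x y z
      unfolding \<psi>_def using F3_swap(2)[of x y z] F3_swap(2)[of "M *v x" "M *v y" "M *v z"] dot_commute[of y z]
      by simp
    moreover have "\<psi> v v v = 0" if "v \<in> hyp r" for v
      using F[OF that] by (simp add: \<psi>_def F3_diag humQ_dot)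
    ultimately have "\<psi> x y z = 0"
      using that by (rule symmetric_trilinear_polarization)
    then show ?thesis by (simp add: \<psi>_def)
  qed
  define m where "m = csqrt \<mu>"
  have m: "m^2 = \<mu>" "m \<noteq> 0" using \<mu>0 by (simp_all add: m_def)
  define S where "S = dot r r"
  have S: "S \<noteq> 0" "dot r r = S" using assms(2) by (simp_all add: S_def)
  define R :: "complex \<Rightarrow> complex^6^6" where "R c = (\<chi> i j. c * r$i * r$j)" for c
  have R: "R c *v u = (c * dot r u) *s r" for c u
    by (simp add: R_def vec_eq_iff matrix_vector_mult_def dot_def sum_distrib_left sum_distrib_right mult_ac)
  \<comment> \<open>\<open>R (1/S)\<close> is the orthogonal projection onto the line of
    \<open>r\<close>. So \<open>A\<close> is \<open>M\<close> on the hyperplane and multiplication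
    by \<open>m\<close> on \<open>r\<close>; since \<open>m^2 = \<mu>\<close>, both parts scale
    \<open>dot\<close> by the same factor.\<close>
  define A where "A = M ** (mat 1 - R (1/S)) + R (m/S)"
  have A: "A *v u = M *v (u - (dot r u / S) *s r) + (m * dot r u / S) *s r" for u
    unfolding A_def matrix_vector_mult_add_rdistrib matrix_vector_mul_assoc[symmetric]
      matrix_vector_mult_diff_rdistrib matrix_vector_mul_lid R by simp
  have Ah: "A *v v = M *v v" if "v \<in> hyp r" for v
    using that by (simp add: A hyp_iff_dot)
  have Ar: "A *v r = m *s r" using S by (simp add: A)
  have orth: "dot (A *v u) (A *v v) = m^2 * dot u v" for u v
  proof -
    define a where "a u = dot r u / S" for u
    define x where "x u = u - a u *s r" for u
    have xh: "x u \<in> hyp r" for u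
      using S by (simp add: hyp_iff_dot x_def a_def linear_formD[OF linear_form_dot])
    have Au: "A *v u = M *v x u + (m * a u) *s r" for u by (simp add: A x_def a_def)
    have ux: "u = x u + a u *s r" for u by (simp add: x_def)
    have z0: "dot r (M *v x u) = 0" "dot r (x u) = 0" for u
      using xh Mh[OF xh] by (simp_all add: hyp_iff_dot)
    have z0': "dot (M *v x u) r = 0" "dot (x u) r = 0" for u
      using z0 by (simp_all add: dot_commute)
    have "dot u v = dot (x u) (x v) + a u * a v * S"
      by (subst ux[of u], subst ux[of v])
        (simp only: bilinear_formD[OF bilinear_form_dot] z0 z0' S, simp)
    moreover have "dot (A *v u) (A *v v) = dot (M *v x u) (M *v x v) + m^2 * (a u * a v * S)"
      unfolding Au bilinear_formD[OF bilinear_form_dot] z0 z0' S by (simp add: power2_eq_square)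
    ultimately show ?thesis by (simp add: orthM[OF xh xh] m algebra_simps)
  qed
  have "\<exists>c. \<forall>v\<in>hyp r. A *v v = c *s v"
  proof (rule similitude_scalar[OF assms(2) m(2) Ar orth _ T0 K0])
    show "harm r (A *v u) (A *v v) (A *v w) = d * harm r u v w" for u v w
      by (rule harm_invariant[OF assms(2) m(2) Ar orth l]) (simp add: Ah F3M)
  qed
  then show ?thesis unfolding trivial_on_R_def using Ah by metis
qed

section \<open>A hyperplane with nondegenerate covariants\<close>

text \<open>Lets a scaled inverse serve as a certificate, in place of expanding a determinant with
  huge entries.\<close>

lemma det_nonzero_of_mult_eq_mat:
  fixes A B :: "complex^6^6"
  assumes "A ** B = mat c" "c \<noteq> 0"
  shows "det B \<noteq> 0"
proof -
  have "det (mat c :: complex^6^6) \<noteq> 0"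
    using assms(2) by (subst det_diagonal) (simp_all add: mat_def)
  then show ?thesis using det_mul[of A B] assms(1) by auto
qed

text \<open>Imaginary \<open>y\<close>-coordinates make all values below integers up to powers of \<open>\<i>\<close>.\<close>
definition r0 :: "complex^6" where
  "r0 = vector [0, 2, 3, \<i>, 2 * \<i>, 3 * \<i>]"

lemma r0_nth: "r0$1 = 0" "r0$2 = 2" "r0$3 = 3" "r0$4 = \<i>" "r0$5 = 2 * \<i>" "r0$6 = 3 * \<i>"
  by (simp_all add: r0_def vector_6)

lemma ii_mult: "x * \<i> * \<i> = - x" "\<i> * (x * \<i>) = - x" "\<i> * (\<i> * x) = - x"
  "x * \<i> * (y * \<i>) = - (x * y)"
  by (simp_all add: algebra_simps)

lemma dot_r0_r0: "dot r0 r0 = -1"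
  by (simp add: dot_6 r0_nth)

lemma proj_r0_nth:
  "proj r0 (axis 1 1) $ 1 = - 1" "proj r0 (axis 1 1) $ 2 = 0" "proj r0 (axis 1 1) $ 3 = 0"
    "proj r0 (axis 1 1) $ 4 = 0" "proj r0 (axis 1 1) $ 5 = 0" "proj r0 (axis 1 1) $ 6 = 0"
  "proj r0 (axis 2 1) $ 1 = 0" "proj r0 (axis 2 1) $ 2 = - 5" "proj r0 (axis 2 1) $ 3 = - 6"
    "proj r0 (axis 2 1) $ 4 = - 2 * \<i>" "proj r0 (axis 2 1) $ 5 = - 4 * \<i>"
    "proj r0 (axis 2 1) $ 6 = - 6 * \<i>"
  "proj r0 (axis 3 1) $ 1 = 0" "proj r0 (axis 3 1) $ 2 = - 6" "proj r0 (axis 3 1) $ 3 = - 10"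
    "proj r0 (axis 3 1) $ 4 = - 3 * \<i>" "proj r0 (axis 3 1) $ 5 = - 6 * \<i>"
    "proj r0 (axis 3 1) $ 6 = - 9 * \<i>"
  "proj r0 (axis 4 1) $ 1 = 0" "proj r0 (axis 4 1) $ 2 = - 2 * \<i>"
    "proj r0 (axis 4 1) $ 3 = - 3 * \<i>" "proj r0 (axis 4 1) $ 4 = 0"
    "proj r0 (axis 4 1) $ 5 = 2" "proj r0 (axis 4 1) $ 6 = 3"
  "proj r0 (axis 5 1) $ 1 = 0" "proj r0 (axis 5 1) $ 2 = - 4 * \<i>"
    "proj r0 (axis 5 1) $ 3 = - 6 * \<i>" "proj r0 (axis 5 1) $ 4 = 2"
    "proj r0 (axis 5 1) $ 5 = 3" "proj r0 (axis 5 1) $ 6 = 6"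
  "proj r0 (axis 6 1) $ 1 = 0" "proj r0 (axis 6 1) $ 2 = - 6 * \<i>"
    "proj r0 (axis 6 1) $ 3 = - 9 * \<i>" "proj r0 (axis 6 1) $ 4 = 3"
    "proj r0 (axis 6 1) $ 5 = 6" "proj r0 (axis 6 1) $ 6 = 8"
  unfolding proj_def dot_r0_r0 by (simp_all add: dot_6 r0_nth axis_def ii_mult)

lemma F3_proj_r0:
  "F3 (proj r0 (axis 1 1)) r0 r0 = - 12"
  "F3 (proj r0 (axis 2 1)) r0 r0 = - 72"
  "F3 (proj r0 (axis 3 1)) r0 r0 = - 108"
  "F3 (proj r0 (axis 4 1)) r0 r0 = - 24 * \<i>"
  "F3 (proj r0 (axis 5 1)) r0 r0 = - 66 * \<i>"
  "F3 (proj r0 (axis 6 1)) r0 r0 = - 104 * \<i>"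
  by (simp_all add: F3_def proj_r0_nth r0_nth ii_mult)

lemma dot_proj_r0:
  "dot (proj r0 (axis 1 1)) (proj r0 (axis 1 1)) = 1"
  "dot (proj r0 (axis 1 1)) (proj r0 (axis 2 1)) = 0"
  "dot (proj r0 (axis 1 1)) (proj r0 (axis 3 1)) = 0"
  "dot (proj r0 (axis 1 1)) (proj r0 (axis 4 1)) = 0"
  "dot (proj r0 (axis 1 1)) (proj r0 (axis 5 1)) = 0"
  "dot (proj r0 (axis 1 1)) (proj r0 (axis 6 1)) = 0"
  "dot (proj r0 (axis 2 1)) (proj r0 (axis 1 1)) = 0"
  "dot (proj r0 (axis 2 1)) (proj r0 (axis 2 1)) = 5"
  "dot (proj r0 (axis 2 1)) (proj r0 (axis 3 1)) = 6"
  "dot (proj r0 (axis 2 1)) (proj r0 (axis 4 1)) = 2 * \<i>"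
  "dot (proj r0 (axis 2 1)) (proj r0 (axis 5 1)) = 4 * \<i>"
  "dot (proj r0 (axis 2 1)) (proj r0 (axis 6 1)) = 6 * \<i>"
  "dot (proj r0 (axis 3 1)) (proj r0 (axis 1 1)) = 0"
  "dot (proj r0 (axis 3 1)) (proj r0 (axis 2 1)) = 6"
  "dot (proj r0 (axis 3 1)) (proj r0 (axis 3 1)) = 10"
  "dot (proj r0 (axis 3 1)) (proj r0 (axis 4 1)) = 3 * \<i>"
  "dot (proj r0 (axis 3 1)) (proj r0 (axis 5 1)) = 6 * \<i>"
  "dot (proj r0 (axis 3 1)) (proj r0 (axis 6 1)) = 9 * \<i>"
  "dot (proj r0 (axis 4 1)) (proj r0 (axis 1 1)) = 0"
  "dot (proj r0 (axis 4 1)) (proj r0 (axis 2 1)) = 2 * \<i>"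
  "dot (proj r0 (axis 4 1)) (proj r0 (axis 3 1)) = 3 * \<i>"
  "dot (proj r0 (axis 4 1)) (proj r0 (axis 4 1)) = 0"
  "dot (proj r0 (axis 4 1)) (proj r0 (axis 5 1)) = - 2"
  "dot (proj r0 (axis 4 1)) (proj r0 (axis 6 1)) = - 3"
  "dot (proj r0 (axis 5 1)) (proj r0 (axis 1 1)) = 0"
  "dot (proj r0 (axis 5 1)) (proj r0 (axis 2 1)) = 4 * \<i>"
  "dot (proj r0 (axis 5 1)) (proj r0 (axis 3 1)) = 6 * \<i>"
  "dot (proj r0 (axis 5 1)) (proj r0 (axis 4 1)) = - 2"
  "dot (proj r0 (axis 5 1)) (proj r0 (axis 5 1)) = - 3"
  "dot (proj r0 (axis 5 1)) (proj r0 (axis 6 1)) = - 6"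
  "dot (proj r0 (axis 6 1)) (proj r0 (axis 1 1)) = 0"
  "dot (proj r0 (axis 6 1)) (proj r0 (axis 2 1)) = 6 * \<i>"
  "dot (proj r0 (axis 6 1)) (proj r0 (axis 3 1)) = 9 * \<i>"
  "dot (proj r0 (axis 6 1)) (proj r0 (axis 4 1)) = - 3"
  "dot (proj r0 (axis 6 1)) (proj r0 (axis 5 1)) = - 6"
  "dot (proj r0 (axis 6 1)) (proj r0 (axis 6 1)) = - 8"
  by (simp_all add: dot_6 proj_r0_nth ii_mult)

text \<open>The six slices form one symmetric array; a nonzero entry is a multiple of
  \<open>\<i>\<close> exactly when an odd number of its three indices lies in {4, 5, 6}.\<close>

lemma slice_r0_1: "slice r0 (axis 1 1) = vector [
    vector [- 36, - 72, - 108, - 24 * \<i>, - 66 * \<i>, - 104 * \<i>],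
    vector [- 72, 360, 530, 165 * \<i>, 330 * \<i>, 495 * \<i>],
    vector [- 108, 530, 720, 230 * \<i>, 460 * \<i>, 690 * \<i>],
    vector [- 24 * \<i>, 165 * \<i>, 230 * \<i>, - 84, - 144, - 216],
    vector [- 66 * \<i>, 330 * \<i>, 460 * \<i>, - 144, - 300, - 432],
    vector [- 104 * \<i>, 495 * \<i>, 690 * \<i>, - 216, - 432, - 660]]"
  unfolding vec_eq_iff forall_6 vector_6 slice_def vec_lambda_beta harm_def cyc_def F3_proj_r0 dot_proj_r0 dot_r0_r0
  by (simp add: F3_def proj_r0_nth ii_mult)

lemma slice_r0_2: "slice r0 (axis 2 1) = vector [
    vector [- 72, 360, 530, 165 * \<i>, 330 * \<i>, 495 * \<i>],
    vector [360, 936, 1620, 264 * \<i>, 942 * \<i>, 1528 * \<i>],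
    vector [530, 1620, 2520, 432 * \<i>, 1512 * \<i>, 2448 * \<i>],
    vector [165 * \<i>, 264 * \<i>, 432 * \<i>, - 72, - 258, - 412],
    vector [330 * \<i>, 942 * \<i>, 1512 * \<i>, - 258, - 936, - 1430],
    vector [495 * \<i>, 1528 * \<i>, 2448 * \<i>, - 412, - 1430, - 2376]]"
  unfolding vec_eq_iff forall_6 vector_6 slice_def vec_lambda_beta harm_def cyc_def F3_proj_r0 dot_proj_r0 dot_r0_r0
  by (simp add: F3_def proj_r0_nth ii_mult)

lemma slice_r0_3: "slice r0 (axis 3 1) = vector [
    vector [- 108, 530, 720, 230 * \<i>, 460 * \<i>, 690 * \<i>],
    vector [530, 1620, 2520, 432 * \<i>, 1512 * \<i>, 2448 * \<i>],
    vector [720, 2520, 3564, 624 * \<i>, 2202 * \<i>, 3568 * \<i>],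
    vector [230 * \<i>, 432 * \<i>, 624 * \<i>, - 108, - 387, - 618],
    vector [460 * \<i>, 1512 * \<i>, 2202 * \<i>, - 387, - 1404, - 2145],
    vector [690 * \<i>, 2448 * \<i>, 3568 * \<i>, - 618, - 2145, - 3564]]"
  unfolding vec_eq_iff forall_6 vector_6 slice_def vec_lambda_beta harm_def cyc_def F3_proj_r0 dot_proj_r0 dot_r0_r0
  by (simp add: F3_def proj_r0_nth ii_mult)

lemma slice_r0_4: "slice r0 (axis 4 1) = vector [
    vector [- 24 * \<i>, 165 * \<i>, 230 * \<i>, - 84, - 144, - 216],
    vector [165 * \<i>, 264 * \<i>, 432 * \<i>, - 72, - 258, - 412],
    vector [230 * \<i>, 432 * \<i>, 624 * \<i>, - 108, - 387, - 618],
    vector [- 84, - 72, - 108, 0, - 72 * \<i>, - 108 * \<i>],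
    vector [- 144, - 258, - 387, - 72 * \<i>, - 252 * \<i>, - 367 * \<i>],
    vector [- 216, - 412, - 618, - 108 * \<i>, - 367 * \<i>, - 612 * \<i>]]"
  unfolding vec_eq_iff forall_6 vector_6 slice_def vec_lambda_beta harm_def cyc_def F3_proj_r0 dot_proj_r0 dot_r0_r0
  by (simp add: F3_def proj_r0_nth ii_mult)

lemma slice_r0_5: "slice r0 (axis 5 1) = vector [
    vector [- 66 * \<i>, 330 * \<i>, 460 * \<i>, - 144, - 300, - 432],
    vector [330 * \<i>, 942 * \<i>, 1512 * \<i>, - 258, - 936, - 1430],
    vector [460 * \<i>, 1512 * \<i>, 2202 * \<i>, - 387, - 1404, - 2145],
    vector [- 144, - 258, - 387, - 72 * \<i>, - 252 * \<i>, - 367 * \<i>],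
    vector [- 300, - 936, - 1404, - 252 * \<i>, - 918 * \<i>, - 1332 * \<i>],
    vector [- 432, - 1430, - 2145, - 367 * \<i>, - 1332 * \<i>, - 2088 * \<i>]]"
  unfolding vec_eq_iff forall_6 vector_6 slice_def vec_lambda_beta harm_def cyc_def F3_proj_r0 dot_proj_r0 dot_r0_r0
  by (simp add: F3_def proj_r0_nth ii_mult)

lemma slice_r0_6: "slice r0 (axis 6 1) = vector [
    vector [- 104 * \<i>, 495 * \<i>, 690 * \<i>, - 216, - 432, - 660],
    vector [495 * \<i>, 1528 * \<i>, 2448 * \<i>, - 412, - 1430, - 2376],
    vector [690 * \<i>, 2448 * \<i>, 3568 * \<i>, - 618, - 2145, - 3564],
    vector [- 216, - 412, - 618, - 108 * \<i>, - 367 * \<i>, - 612 * \<i>],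
    vector [- 432, - 1430, - 2145, - 367 * \<i>, - 1332 * \<i>, - 2088 * \<i>],
    vector [- 660, - 2376, - 3564, - 612 * \<i>, - 2088 * \<i>, - 3552 * \<i>]]"
  unfolding vec_eq_iff forall_6 vector_6 slice_def vec_lambda_beta harm_def cyc_def F3_proj_r0 dot_proj_r0 dot_r0_r0
  by (simp add: F3_def proj_r0_nth ii_mult)

lemmas slice_r0 = slice_r0_1 slice_r0_2 slice_r0_3 slice_r0_4 slice_r0_5 slice_r0_6

lemma Tmat_r0: "Tmat r0 = vector [
    vector [10484, 12528, 21312, 1152 * \<i>, 12240 * \<i>, 21120 * \<i>],
    vector [12528, 113620, 161280, 40252 * \<i>, 102152 * \<i>, 155508 * \<i>],
    vector [21312, 161280, 238220, 58278 * \<i>, 149028 * \<i>, 226962 * \<i>],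
    vector [1152 * \<i>, 40252 * \<i>, 58278 * \<i>, - 15674, - 36456, - 55584],
    vector [12240 * \<i>, 102152 * \<i>, 149028 * \<i>, - 36456, - 92438, - 143352],
    vector [21120 * \<i>, 155508 * \<i>, 226962 * \<i>, - 55584, - 143352, - 216538]]"
  unfolding vec_eq_iff forall_6 vector_6 Tmat_def vec_lambda_beta trace_def matrix_matrix_mult_def transpose_def
    sum_6 slice_r0
  by (simp add: ii_mult)

lemma trace_Tmat_r0: "trace (Tmat r0) \<noteq> 0"
  by (simp add: Tmat_r0 trace_def sum_6 vector_6)

lemma wvec_r0: "wvec r0 = vector [1210728, 6283920, 9244440, 2020272 * \<i>, 5745252 * \<i>,
  8930128 * \<i>]"
  unfolding vec_eq_iff forall_6 vector_6 wvec_def vec_lambda_beta trace_def matrix_matrix_mult_def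
    sum_6 slice_r0 Tmat_r0
  by (simp add: ii_mult)

lemma Tmat_r0_mult: "Tmat r0 *v x = vector [
    (10484) * x$1 + (12528) * x$2 + (21312) * x$3 + (1152 * \<i>) * x$4 + (12240 * \<i>) * x$5
      + (21120 * \<i>) * x$6,
    (12528) * x$1 + (113620) * x$2 + (161280) * x$3 + (40252 * \<i>) * x$4
      + (102152 * \<i>) * x$5 + (155508 * \<i>) * x$6,
    (21312) * x$1 + (161280) * x$2 + (238220) * x$3 + (58278 * \<i>) * x$4
      + (149028 * \<i>) * x$5 + (226962 * \<i>) * x$6,
    (1152 * \<i>) * x$1 + (40252 * \<i>) * x$2 + (58278 * \<i>) * x$3 + (- 15674) * x$4
      + (- 36456) * x$5 + (- 55584) * x$6,
    (12240 * \<i>) * x$1 + (102152 * \<i>) * x$2 + (149028 * \<i>) * x$3 + (- 36456) * x$4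
      + (- 92438) * x$5 + (- 143352) * x$6,
    (21120 * \<i>) * x$1 + (155508 * \<i>) * x$2 + (226962 * \<i>) * x$3 + (- 55584) * x$4
      + (- 143352) * x$5 + (- 216538) * x$6]"
  unfolding vec_eq_iff forall_6 vector_6 Tmat_r0 matrix_vector_mult_def vec_lambda_beta sum_6 by simp

lemma krylov_r0: "krylov r0 = vector [r0,
    vector [1210728, 6283920, 9244440, 2020272 * \<i>, 5745252 * \<i>, 8930128 * \<i>],
    vector [27182186208, 163174958112, 240743611728, 55595695824 * \<i>, 149532361416 * \<i>,
      231306777584 * \<i>],
    vector [680440280683776, 4224684768783552, 6223743610257888, 1449773867364096 * \<i>,
      3871338957089808 * \<i>, 5976049528932352 * \<i>],
    vector [17431516126791193344, 109153783728995846784, 160714928882008812096,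
      37513183002125707200 * \<i>, 100010211590255675424 * \<i>, 154306249307127023936 * \<i>],
    vector [449099019913809615505920, 2818458677593258436288256, 4149163022664094931528064,
      968971369026286094443776 * \<i>, 2582229505123495154452032 * \<i>,
      3983658681301841754604288 * \<i>]]"
proof -
  have 1: "Tmat r0 *v vector [1210728, 6283920, 9244440, 2020272 * \<i>, 5745252 * \<i>,
    8930128 * \<i>] =
      vector [27182186208, 163174958112, 240743611728, 55595695824 * \<i>, 149532361416 * \<i>,
        231306777584 * \<i>]"
    unfolding Tmat_r0_mult vector_6 by (simp add: ii_mult)
  have 2: "Tmat r0 *v vector [27182186208, 163174958112, 240743611728, 55595695824 * \<i>,
    149532361416 * \<i>, 231306777584 * \<i>] =
      vector [680440280683776, 4224684768783552, 6223743610257888, 1449773867364096 * \<i>,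
        3871338957089808 * \<i>, 5976049528932352 * \<i>]"
    unfolding Tmat_r0_mult vector_6 by (simp add: ii_mult)
  have 3: "Tmat r0 *v vector [680440280683776, 4224684768783552, 6223743610257888,
    1449773867364096 * \<i>, 3871338957089808 * \<i>, 5976049528932352 * \<i>] =
      vector [17431516126791193344, 109153783728995846784, 160714928882008812096,
        37513183002125707200 * \<i>, 100010211590255675424 * \<i>, 154306249307127023936 * \<i>]"
    unfolding Tmat_r0_mult vector_6 by (simp add: ii_mult)
  have 4: "Tmat r0 *v vector [17431516126791193344, 109153783728995846784, 160714928882008812096,
    37513183002125707200 * \<i>, 100010211590255675424 * \<i>, 154306249307127023936 * \<i>] =
      vector [449099019913809615505920, 2818458677593258436288256, 4149163022664094931528064,
        968971369026286094443776 * \<i>, 2582229505123495154452032 * \<i>,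
        3983658681301841754604288 * \<i>]"
    unfolding Tmat_r0_mult vector_6 by (simp add: ii_mult)
  show ?thesis unfolding krylov_def Let_def wvec_r0 1 2 3 4 ..
qed

lemma det_krylov_r0: "det (krylov r0) \<noteq> 0"
proof -
  \<comment> \<open>a multiple of the inverse matrix\<close>
  let ?B = "vector [
      vector [0, - 926993415709914604503630279509401877747200,
        1685589285466600526552746871800643392960, - 749416026567367667333132626138214880,
        95249081567388925750253712582800, - 2661018962272100173955893160],
      vector [- 75413905308646218877019973803852076907295846400,
        - 606896587740581453702425943131141449164480, 969655587647618886347127742096432495568,
        - 350029791629328471791527396675352328, 38634114353866009844458063443916,
        - 1026275652699943407744404434],
      vector [- 113120857962969328315529960705778115360943769600,
        16767856832582820949092084655998153390720, - 582957471599811243550803395493249924192,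
        214406593033203987001596737945448432, - 23486585489969658762627356524104,
        622004627558339483498784396],
      vector [- 37706952654323109438509986901926038453647923200 * \<i>,
        1591107793776789795478271499969557735243200 * \<i>,
        - 2321524762071111493538029200596057941600 * \<i>,
        971015664933728781032394460220455740 * \<i>, - 120376285023363944145915575884460 * \<i>,
        3337350195001395357787464335 * \<i>],
      vector [- 75413905308646218877019973803852076907295846400 * \<i>,
        - 799557721195435270882448858101177233779200 * \<i>,
        203494984035293824291793600559759789184 * \<i>,
        129310239824706212411455787534025216 * \<i>, - 26780789261092180387313012965792 * \<i>,
        833398550848256958744187648 * \<i>],
      vector [- 113120857962969328315529960705778115360943769600 * \<i>,
        - 385160652123111232756983138687163901947200 * \<i>,
        701657851498775962332095765729884527264 * \<i>,
        - 428825316247395396144523538267621844 * \<i>, 60248778594457116107191886377188 * \<i>,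
        - 1730228239807592546756098437 * \<i>]] :: complex^6^6"
  have "?B ** krylov r0 = mat 37706952654323109438509986901926038453647923200"
    unfolding vec_eq_iff forall_6 krylov_r0 matrix_matrix_mult_def vec_lambda_beta sum_6 vector_6 r0_nth mat_def
    by (simp add: mult.assoc)
  then show ?thesis by (rule det_nonzero_of_mult_eq_mat) simp
qed

section \<open>Hyperplanes normal to the complex\<close>

text \<open>Gaussian elimination by induction on the equations: a pivot in the equation
  \<open>j0\<close> removes one equation and one unknown, so unknowns still outnumber
  equations.\<close>

lemma homogeneous_system_nontrivial_solution:
  fixes C :: "'i \<Rightarrow> 'j \<Rightarrow> complex"
  assumes "finite J" "finite I" "card J < card I"
  shows "\<exists>c. (\<exists>i\<in>I. c i \<noteq> 0) \<and> (\<forall>j\<in>J. (\<Sum>i\<in>I. c i * C i j) = 0)"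
  using assms
proof (induction J arbitrary: I C rule: finite_induct)
  case empty
  then have "I \<noteq> {}" by auto
  then show ?case by (intro exI[of _ "\<lambda>_. 1"]) auto
next
  case (insert j0 J)
  show ?case
  proof (cases "\<forall>i\<in>I. C i j0 = 0")
    case True
    have "card J < card I" using insert.prems insert.hyps by simp
    from insert.IH[OF insert.prems(1) this] True show ?thesis by auto
  next
    case False
    then obtain i0 where i0: "i0 \<in> I" "C i0 j0 \<noteq> 0" by blast
    define I' where "I' = I - {i0}"
    have fin: "finite I'" and I: "I = insert i0 I'" "i0 \<notin> I'"
      using insert.prems(1) i0(1) by (auto simp: I'_def)
    have "card J < card I'" using insert.prems insert.hyps fin I by simp
    from insert.IH[OF fin this, of "\<lambda>i j. C i j - C i j0 / C i0 j0 * C i0 j"]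
    obtain c where c: "\<exists>i\<in>I'. c i \<noteq> 0"
      "\<And>j. j \<in> J \<Longrightarrow> (\<Sum>i\<in>I'. c i * (C i j - C i j0 / C i0 j0 * C i0 j)) = 0" by blast
    define d where "d = (\<Sum>i\<in>I'. c i * C i j0) / C i0 j0"
    \<comment> \<open>The value \<open>- d\<close> at the pivot unknown solves the equation
      \<open>j0\<close>; the others hold by the choice of the eliminated coefficients.\<close>
    define c' where "c' = c(i0 := - d)"
    have c': "(\<Sum>i\<in>I. c' i * C i j) = (\<Sum>i\<in>I'. c i * C i j) - d * C i0 j" for j
    proof -
      have "(\<Sum>i\<in>I'. c' i * C i j) = (\<Sum>i\<in>I'. c i * C i j)"
        using I by (intro sum.cong) (auto simp: c'_def)
      then show ?thesis using fin I by (simp add: c'_def)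
    qed
    have "(\<Sum>i\<in>I. c' i * C i j) = 0" if "j \<in> J" for j
    proof -
      have "d * C i0 j = (\<Sum>i\<in>I'. c i * (C i j0 / C i0 j0 * C i0 j))"
        by (simp add: d_def sum_distrib_right sum_divide_distrib mult.assoc)
      then show ?thesis
        using c(2)[OF that] by (simp add: c' right_diff_distrib sum_subtractf)
    qed
    moreover have "(\<Sum>i\<in>I. c' i * C i j0) = 0" using i0(2) by (simp add: c' d_def)
    moreover have "\<exists>i\<in>I. c' i \<noteq> 0" using c(1) I by (auto simp: c'_def)
    ultimately show ?thesis by blast
  qed
qed

section \<open>Normal forms of monomials in (a, w) on the cone over the complex\<close>

type_synonym expo = "nat \<times> nat \<times> nat \<times> nat \<times> nat \<times> nat \<times> nat"

fun wmono :: "expo \<Rightarrow> complex \<Rightarrow> complex^6 \<Rightarrow> complex" where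
  "wmono (k, b1, b2, b3, b4, b5, b6) a w =
     a^k * (w$1^b1 * w$2^b2 * w$3^b3 * w$4^b4 * w$5^b5 * w$6^b6)"

fun tdeg :: "expo \<Rightarrow> nat" where
  "tdeg (k, b1, b2, b3, b4, b5, b6) = k + b1 + b2 + b3 + b4 + b5 + b6"

text \<open>The monomials divisible neither by w1^2 nor by w4 w5 w6, which serve as leading terms of
  Q and F. A box bound on each exponent replaces a bound on the total degree to make counting
  easy.\<close>

definition reduced_expos :: "nat \<Rightarrow> expo set" where
  "reduced_expos E = {(k, b1, b2, b3, b4, b5, b6).
     k \<le> E \<and> b1 \<le> 1 \<and> b2 \<le> E \<and> b3 \<le> E \<and> b4 \<le> E \<and> b5 \<le> E \<and> b6 \<le> E \<and> (b4 = 0 \<or> b5 = 0 \<or> b6 = 0)}"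

lemma reduced_expos_subset:
  "reduced_expos E \<subseteq>
     {..E} \<times> {..1} \<times> {..E} \<times> {..E} \<times> {0} \<times> {..E} \<times> {..E} \<union>
     {..E} \<times> {..1} \<times> {..E} \<times> {..E} \<times> {..E} \<times> {0} \<times> {..E} \<union>
     {..E} \<times> {..1} \<times> {..E} \<times> {..E} \<times> {..E} \<times> {..E} \<times> {0}"
  unfolding reduced_expos_def by auto

lemma finite_reduced_expos: "finite (reduced_expos E)"
  by (rule finite_subset[OF reduced_expos_subset]) simp

text \<open>One of the last three exponents is zero; each of the three cases leaves two values for
  \<open>b1\<close> and five exponents up to \<open>E\<close>. The growth of order five, against six
  coordinates of \<open>r\<close>, is the dimension count.\<close>

lemma card_reduced_expos: "card (reduced_expos E) \<le> 6 * (E + 1)^5"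
proof -
  let ?A = "{..E} \<times> {..1} \<times> {..E} \<times> {..E} \<times> {0} \<times> {..E} \<times> {..E} :: expo set"
  \<comment> \<open>a multiple of the inverse matrix\<close>
  let ?B = "{..E} \<times> {..1} \<times> {..E} \<times> {..E} \<times> {..E} \<times> {0} \<times> {..E} :: expo set"
  let ?C = "{..E} \<times> {..1} \<times> {..E} \<times> {..E} \<times> {..E} \<times> {..E} \<times> {0} :: expo set"
  have "card (reduced_expos E) \<le> card (?A \<union> ?B \<union> ?C)"
    by (rule card_mono[OF _ reduced_expos_subset]) simp
  also have "\<dots> \<le> card ?A + card ?B + card ?C"
    using card_Un_le[of "?A \<union> ?B" ?C] card_Un_le[of ?A ?B] by linarith
  also have "\<dots> = 6 * (E + 1)^5"
    by (simp add: card_cartesian_product numeral_eq_Suc algebra_simps)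
  finally show ?thesis .
qed

definition reducible_to :: "nat \<Rightarrow> (complex \<Rightarrow> complex^6 \<Rightarrow> complex) \<Rightarrow> bool" where
  "reducible_to E f \<longleftrightarrow> (\<exists>C. \<forall>a w. humQ w = 0 \<longrightarrow> humF w = 0 \<longrightarrow>
     f a w = (\<Sum>e\<in>reduced_expos E. C e * wmono e a w))"

lemma reducible_to_add:
  assumes "reducible_to E f" "reducible_to E g"
  shows "reducible_to E (\<lambda>a w. f a w + g a w)"
proof -
  obtain C D where "\<forall>a w. humQ w = 0 \<longrightarrow> humF w = 0 \<longrightarrow> f a w = (\<Sum>e\<in>reduced_expos E. C e * wmono e a w)"
    "\<forall>a w. humQ w = 0 \<longrightarrow> humF w = 0 \<longrightarrow> g a w = (\<Sum>e\<in>reduced_expos E. D e * wmono e a w)"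
    using assms unfolding reducible_to_def by blast
  then show ?thesis unfolding reducible_to_def
    by (intro exI[of _ "\<lambda>e. C e + D e"]) (simp add: distrib_right sum.distrib)
qed

lemma reducible_to_scale:
  assumes "reducible_to E f"
  shows "reducible_to E (\<lambda>a w. c * f a w)"
proof -
  obtain C where "\<forall>a w. humQ w = 0 \<longrightarrow> humF w = 0 \<longrightarrow> f a w = (\<Sum>e\<in>reduced_expos E. C e * wmono e a w)"
    using assms unfolding reducible_to_def by blast
  then show ?thesis unfolding reducible_to_def
    by (intro exI[of _ "\<lambda>e. c * C e"]) (simp add: sum_distrib_left mult.assoc)
qed

lemma reducible_to_cong:
  assumes "\<And>a w. humQ w = 0 \<Longrightarrow> humF w = 0 \<Longrightarrow> f a w = g a w" "reducible_to E g"
  shows "reducible_to E f"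
  using assms unfolding reducible_to_def by auto

lemma reducible_to_reduced:
  assumes "e \<in> reduced_expos E"
  shows "reducible_to E (wmono e)"
proof -
  have "wmono e a w = (\<Sum>e'\<in>reduced_expos E. (if e' = e then 1 else 0) * wmono e' a w)" for a w
    using assms finite_reduced_expos[of E] by (simp add: if_distrib[of "\<lambda>x. x * _"] cong: if_cong)
  then show ?thesis unfolding reducible_to_def
    by (intro exI[of _ "\<lambda>e'. if e' = e then 1 else 0"]) blast
qed

text \<open>Rewriting with \<open>w\<^sub>1\<^sup>2 = - (w\<^sub>2\<^sup>2 + \<dots> + w\<^sub>6\<^sup>2)\<close> and \<open>w\<^sub>4 w\<^sub>5 w\<^sub>6 = \<i> w\<^sub>1 w\<^sub>2 w\<^sub>3\<close> lowers
  the weight \<open>(3,0,0,2,2,2)\<close>.\<close>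
lemma reducible_to_mono:
  assumes "tdeg e \<le> E"
  shows "reducible_to E (wmono e)"
  using assms
proof (induction "case e of (k, b1, b2, b3, b4, b5, b6) \<Rightarrow> 3 * b1 + 2 * (b4 + b5 + b6)"
    arbitrary: e rule: less_induct)
  case less
  obtain k b1 b2 b3 b4 b5 b6 where e: "e = (k, b1, b2, b3, b4, b5, b6)" by (cases e)
  consider "b1 \<ge> 2" | "b4 \<ge> 1" "b5 \<ge> 1" "b6 \<ge> 1" | "b1 \<le> 1" "b4 = 0 \<or> b5 = 0 \<or> b6 = 0" by linarith
  then show ?case
  proof cases
    case 1
    then obtain b where b: "b1 = b + 2" using le_Suc_ex by (metis add.commute)
    \<comment> \<open>Q is homogeneous, so the rewriting keeps the total degree and the bound
      \<open>E\<close> persists.\<close>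
    have r: "reducible_to E (wmono e')"
      if "e' \<in> {(k, b, b2+2, b3, b4, b5, b6), (k, b, b2, b3+2, b4, b5, b6), (k, b, b2, b3, b4+2, b5, b6),
        (k, b, b2, b3, b4, b5+2, b6), (k, b, b2, b3, b4, b5, b6+2)}" for e'
      by (rule less.hyps) (use that less.prems in \<open>auto simp: e b\<close>)
    have eq: "wmono e a w = (-1) * (wmono (k, b, b2+2, b3, b4, b5, b6) a w + (wmono (k, b, b2, b3+2, b4, b5, b6) a w
        + (wmono (k, b, b2, b3, b4+2, b5, b6) a w + (wmono (k, b, b2, b3, b4, b5+2, b6) a w
        + wmono (k, b, b2, b3, b4, b5, b6+2) a w))))" if "humQ w = 0" for a w
    proof -
      have *: "(w$1)^2 = - ((w$2)^2 + (w$3)^2 + (w$4)^2 + (w$5)^2 + (w$6)^2)"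
        using that unfolding humQ_def by algebra
      show ?thesis unfolding e b wmono.simps power_add * by (simp add: algebra_simps)
    qed
    show ?thesis
      by (rule reducible_to_cong, rule eq, assumption) (intro reducible_to_scale reducible_to_add r; simp)
  next
    case 2
    then obtain c4 c5 c6 where c: "b4 = c4 + 1" "b5 = c5 + 1" "b6 = c6 + 1"
      by (metis le_Suc_ex add.commute)
    have r: "reducible_to E (wmono (k, b1+1, b2+1, b3+1, c4, c5, c6))"
      by (rule less.hyps) (use less.prems in \<open>auto simp: e c\<close>)
    have eq: "wmono e a w = \<i> * wmono (k, b1+1, b2+1, b3+1, c4, c5, c6) a w" if "humF w = 0" for a w
    proof -
      have "\<i> * (w$4 * w$5 * w$6) = - (w$1 * w$2 * w$3)"
        using that unfolding humF_def by algebra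
      then have "\<i> * (\<i> * (w$4 * w$5 * w$6)) = - \<i> * (w$1 * w$2 * w$3)" by simp
      then have *: "w$4 * w$5 * w$6 = \<i> * (w$1 * w$2 * w$3)" by simp
      have "wmono e a w = a^k * (w$1^b1 * w$2^b2 * w$3^b3 * w$4^c4 * w$5^c5 * w$6^c6) * (w$4 * w$5 * w$6)"
        by (simp add: e c mult_ac)
      then show ?thesis unfolding * by (simp add: mult_ac)
    qed
    show ?thesis
      by (rule reducible_to_cong, rule eq, assumption) (intro reducible_to_scale r)
  next
    case 3
    then have "e \<in> reduced_expos E" using less.prems by (auto simp: e reduced_expos_def)
    then show ?thesis by (rule reducible_to_reduced)
  qed
qed

text \<open>Sums of monomials in (a, w) before any reduction modulo Q and F; generating them by
  addition makes closure under products a double induction.\<close>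

inductive deg_le :: "nat \<Rightarrow> (complex \<Rightarrow> complex^6 \<Rightarrow> complex) \<Rightarrow> bool" for D where
  mono: "tdeg e \<le> D \<Longrightarrow> deg_le D (\<lambda>a w. c * wmono e a w)"
| add: "deg_le D f \<Longrightarrow> deg_le D g \<Longrightarrow> deg_le D (\<lambda>a w. f a w + g a w)"

lemma deg_le_reducible: "deg_le D f \<Longrightarrow> reducible_to D f"
  by (induction rule: deg_le.induct)
    (auto intro: reducible_to_add reducible_to_scale reducible_to_mono)

lemma deg_le_mult_mono:
  assumes "deg_le D f" "tdeg e \<le> E"
  shows "deg_le (D + E) (\<lambda>a w. f a w * (c * wmono e a w))"
  using assms(1)
proof induction
  case (mono e' c')
  obtain k b1 b2 b3 b4 b5 b6 where e: "e = (k, b1, b2, b3, b4, b5, b6)" by (cases e)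
  obtain k' b1' b2' b3' b4' b5' b6' where e': "e' = (k', b1', b2', b3', b4', b5', b6')" by (cases e')
  let ?e = "(k' + k, b1' + b1, b2' + b2, b3' + b3, b4' + b4, b5' + b5, b6' + b6)"
  have "deg_le (D + E) (\<lambda>a w. (c' * c) * wmono ?e a w)"
    using mono assms(2) by (intro deg_le.mono) (simp add: e e')
  then show ?case by (simp add: e e' power_add mult_ac)
next
  case (add f g)
  then show ?case by (simp add: distrib_right deg_le.add)
qed

lemma deg_le_mult:
  assumes "deg_le D f" "deg_le E g"
  shows "deg_le (D + E) (\<lambda>a w. f a w * g a w)"
  using assms(2)
proof induction
  case (mono e c)
  then show ?case using deg_le_mult_mono[OF assms(1)] by simp
next
  case (add g h)
  then show ?case by (simp add: distrib_left deg_le.add)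
qed

lemma deg_le_power: "deg_le D f \<Longrightarrow> deg_le (D * n) (\<lambda>a w. f a w ^ n)"
proof (induction n)
  case 0
  then show ?case using deg_le.mono[of "(0,0,0,0,0,0,0)" 0 1] by simp
next
  case (Suc n)
  then show ?case using deg_le_mult[of D f "D * n" "\<lambda>a w. f a w ^ n"] by simp
qed

lemma deg_le_weaken: "deg_le D f \<Longrightarrow> D \<le> E \<Longrightarrow> deg_le E f"
  by (induction rule: deg_le.induct) (auto intro: deg_le.intros)

lemma gradF_nth:
  "gradF w $ 1 = w$2 * w$3" "gradF w $ 2 = w$1 * w$3" "gradF w $ 3 = w$1 * w$2"
  "gradF w $ 4 = \<i> * (w$5 * w$6)" "gradF w $ 5 = \<i> * (w$4 * w$6)" "gradF w $ 6 = \<i> * (w$4 * w$5)"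
  by (simp_all add: gradF_def vector_6)

lemma deg_le_normal_coord: "deg_le 2 (\<lambda>a w. (a *s w + gradF w) $ i)"
proof -
  have s: "deg_le 2 (\<lambda>a w. wmono e a w + c * wmono e' a w)" if "tdeg e \<le> 2" "tdeg e' \<le> 2" for e e' c
    using deg_le.add[OF deg_le.mono[OF that(1), of 1] deg_le.mono[OF that(2), of c]] by simp
  show ?thesis
    using exhaust_6[of i]
      s[of "(1,1,0,0,0,0,0)" "(0,0,1,1,0,0,0)" 1] s[of "(1,0,1,0,0,0,0)" "(0,1,0,1,0,0,0)" 1]
      s[of "(1,0,0,1,0,0,0)" "(0,1,1,0,0,0,0)" 1] s[of "(1,0,0,0,1,0,0)" "(0,0,0,0,0,1,1)" \<i>]
      s[of "(1,0,0,0,0,1,0)" "(0,0,0,0,1,0,1)" \<i>] s[of "(1,0,0,0,0,0,1)" "(0,0,0,0,1,1,0)" \<i>]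
    by (auto simp: gradF_nth mult.assoc)
qed

section \<open>Kronecker substitution and linear dependence of monomials\<close>

text \<open>The monomial whose exponents are the base \<open>N\<close> digits of \<open>n\<close>; on the curve
  \<open>r\<^sub>i = t^(N^(i-1))\<close> it takes the value \<open>t^n\<close>.\<close>
definition digit_mono :: "nat \<Rightarrow> nat \<Rightarrow> complex^6 \<Rightarrow> complex" where
  "digit_mono N n r = r$1 ^ (n mod N) * r$2 ^ (n div N mod N) * r$3 ^ (n div N div N mod N)
     * r$4 ^ (n div N div N div N mod N) * r$5 ^ (n div N div N div N div N mod N)
     * r$6 ^ (n div N div N div N div N div N mod N)"

lemma digit_mono_on_curve:
  assumes "n < N^6"
  shows "digit_mono N n (vector [t, t^N, t^(N^2), t^(N^3), t^(N^4), t^(N^5)]) = t^n"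
proof -
  define n1 n2 n3 n4 n5 where n: "n1 = n div N" "n2 = n1 div N" "n3 = n2 div N" "n4 = n3 div N" "n5 = n4 div N"
  have "n < N * (N * (N * (N * (N * N))))" using assms by (simp add: numeral_eq_Suc)
  moreover have "n5 = n div (N * (N * (N * (N * N))))" by (simp add: n div_mult2_eq)
  ultimately have "n5 < N" using less_mult_imp_div_less by simp
  have s: "m mod N + N * (m div N) = m" for m by simp
  have "n mod N + N * (n1 mod N) + N^2 * (n2 mod N) + N^3 * (n3 mod N) + N^4 * (n4 mod N) + N^5 * (n5 mod N)
    = n mod N + N * (n1 mod N + N * (n2 mod N + N * (n3 mod N + N * (n4 mod N + N * n5))))"
    using \<open>n5 < N\<close> by (simp add: numeral_eq_Suc algebra_simps)
  also have "\<dots> = n" using s[of n] s[of n1] s[of n2] s[of n3] s[of n4] by (simp add: n)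
  finally have "t^n = t ^ (n mod N + N * (n1 mod N) + N^2 * (n2 mod N) + N^3 * (n3 mod N) + N^4 * (n4 mod N) + N^5 * (n5 mod N))"
    by simp
  then show ?thesis unfolding digit_mono_def vector_6 n[symmetric] by (simp add: power_add power_mult)
qed

lemma poly_fun_digit_mono: "poly_fun (digit_mono N n)"
  unfolding digit_mono_def by (intro poly_fun_intros)

text \<open>On the curve distinct digit monomials become distinct powers of \<open>t\<close>, so a
  nontrivial combination restricts to a nonzero polynomial in one variable.\<close>

lemma nontrivial_digit_sum:
  assumes "\<exists>n<N^6. c n \<noteq> 0"
  shows "nontrivial_poly (\<lambda>r. \<Sum>n<N^6. c n * digit_mono N n r)"
proof -
  define p where "p = (\<Sum>n<N^6. monom (c n) n)"
  obtain n where n: "n < N^6" "c n \<noteq> 0" using assms by blast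
  have "coeff p n = c n" using n(1) by (simp add: p_def coeff_sum)
  then have "p \<noteq> 0" using n(2) by auto
  then obtain t where t: "poly p t \<noteq> 0" using poly_all_0_iff_0 by blast
  have "(\<Sum>n<N^6. c n * digit_mono N n (vector [t, t^N, t^(N^2), t^(N^3), t^(N^4), t^(N^5)])) = poly p t"
    by (simp add: p_def poly_sum poly_monom digit_mono_on_curve)
  then show ?thesis using t
    by (intro nontrivial_polyI[of _ "vector [t, t^N, t^(N^2), t^(N^3), t^(N^4), t^(N^5)]"] poly_fun_intros poly_fun_digit_mono) simp
qed

text \<open>Six exponents below \<open>N\<close>, each on a coordinate of degree 2 in (a, w), give
  12 \<open>N\<close>.\<close>

lemma deg_le_digit_mono:
  assumes "N > 0"
  shows "deg_le (12 * N) (\<lambda>a w. digit_mono N n (a *s w + gradF w))"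
proof -
  have d: "deg_le (2 * N) (\<lambda>a w. (a *s w + gradF w) $ i ^ (m mod N))" for i m
    by (rule deg_le_weaken[OF deg_le_power[OF deg_le_normal_coord]]) (use assms in \<open>simp add: less_imp_le\<close>)
  have "deg_le (2 * N + 2 * N + 2 * N + 2 * N + 2 * N + 2 * N) (\<lambda>a w. digit_mono N n (a *s w + gradF w))"
    unfolding digit_mono_def by (intro deg_le_mult d)
  then show ?thesis by simp
qed

text \<open>The pairs \<open>(a, w)\<close> with \<open>w\<close> in the cone over the complex depend on five parameters only, so the
  \<open>N^6\<close> digit monomials become linearly dependent on the image once \<open>N\<close> is large.\<close>
lemma normals_not_dense:
  "\<exists>P. nontrivial_poly P \<and> (\<forall>a w. humQ w = 0 \<longrightarrow> humF w = 0 \<longrightarrow> P (a *s w + gradF w) = 0)"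
proof -
  \<comment> \<open>Chosen so that 6 (12 N + 1)^5 \<le> 6 (13 N)^5 < N^6, that is, N exceeds 6 *
    13^5.\<close>
  define N :: nat where "N = 6 * 13^5 + 1"
  have N: "N > 0" by (simp add: N_def)
  let ?J = "reduced_expos (12 * N)"
  have "card ?J \<le> 6 * (12 * N + 1)^5" by (rule card_reduced_expos)
  also have "\<dots> \<le> 6 * (13 * N)^5" using N by (intro mult_left_mono power_mono) auto
  also have "\<dots> = 6 * 13^5 * N^5" by (simp add: power_mult_distrib)
  also have "\<dots> < N * N^5" using N by (intro mult_strict_right_mono) (simp_all add: N_def)
  finally have card: "card ?J < card {..<N^6}" by (simp add: numeral_eq_Suc)
  have "\<forall>n. \<exists>C. \<forall>a w. humQ w = 0 \<longrightarrow> humF w = 0 \<longrightarrow>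
      digit_mono N n (a *s w + gradF w) = (\<Sum>e\<in>?J. C e * wmono e a w)"
    using deg_le_reducible[OF deg_le_digit_mono[OF N]] unfolding reducible_to_def by blast
  from choice[OF this] obtain C where C: "\<And>n a w. humQ w = 0 \<Longrightarrow> humF w = 0 \<Longrightarrow>
      digit_mono N n (a *s w + gradF w) = (\<Sum>e\<in>?J. C n e * wmono e a w)"
    by blast
  obtain c where c: "\<exists>n\<in>{..<N^6}. c n \<noteq> 0" "\<And>e. e \<in> ?J \<Longrightarrow> (\<Sum>n<N^6. c n * C n e) = 0"
    using homogeneous_system_nontrivial_solution[OF finite_reduced_expos finite_lessThan card, of C] by blast
  have "(\<Sum>n<N^6. c n * digit_mono N n (a *s w + gradF w)) = 0" if "humQ w = 0" "humF w = 0" for a w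
  proof -
    have "(\<Sum>n<N^6. c n * digit_mono N n (a *s w + gradF w)) = (\<Sum>n<N^6. \<Sum>e\<in>?J. c n * C n e * wmono e a w)"
      by (simp add: C[OF that] sum_distrib_left mult.assoc)
    also have "\<dots> = (\<Sum>e\<in>?J. (\<Sum>n<N^6. c n * C n e) * wmono e a w)"
      by (subst sum.swap) (simp add: sum_distrib_right)
    also have "\<dots> = 0" using c(2) by simp
    finally show ?thesis .
  qed
  moreover have "nontrivial_poly (\<lambda>r. \<Sum>n<N^6. c n * digit_mono N n r)"
    using c(1) by (intro nontrivial_digit_sum) auto
  ultimately show ?thesis by blast
qed

section \<open>Transversality and the open set\<close>

definition signs :: "(complex \<times> complex \<times> complex \<times> complex \<times> complex) set" where
  "signs = {1,-1} \<times> {1,-1} \<times> {1,-1} \<times> {1,-1} \<times> {1,-1}"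

text \<open>The value of \<open>r\<close> at the point (1, s2, s3, i s4, i s5, i s6). Of the 32 sign
  choices, 16 satisfy F = 0 and give nodes; all of them are excluded to keep the condition
  uniform.\<close>

definition sign_form :: "complex \<times> complex \<times> complex \<times> complex \<times> complex \<Rightarrow> complex^6 \<Rightarrow> complex" where
  "sign_form s r = (case s of (s2, s3, s4, s5, s6) \<Rightarrow>
     r$1 + s2 * r$2 + s3 * r$3 + \<i> * (s4 * r$4 + s5 * r$5 + s6 * r$6))"

text \<open>Each sum of squares is the product of the values of \<open>r\<close> at the two nodes
  e_j + i e_k and e_j - i e_k.\<close>

definition avoids_nodes :: "complex^6 \<Rightarrow> bool" where
  "avoids_nodes r \<longleftrightarrow> (\<forall>j\<in>{1,2,3}. \<forall>k\<in>{4,5,6}. (r$j)^2 + (r$k)^2 \<noteq> 0) \<and> (\<forall>s\<in>signs. sign_form s r \<noteq> 0)"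

lemma linear_relation_sum_squares:
  fixes a b x y :: complex
  assumes "a * x + b * y = 0" "x^2 + y^2 = 0" "a^2 + b^2 \<noteq> 0"
  shows "x = 0 \<and> y = 0"
proof -
  have "(a^2 + b^2) * x^2 = (a * x + b * y) * (a * x - b * y) + b^2 * (x^2 + y^2)" by algebra
  then have "(a^2 + b^2) * x^2 = 0" using assms(1,2) by simp
  then have "x = 0" using assms(3) by simp
  then show ?thesis using assms(2) by simp
qed

text \<open>The points where \<open>gradF\<close> is proportional to the position vector are the nodes of the
  complex: 18 with proportionality factor zero, 16 with all coordinates equal up to fourth roots of unity.\<close>
lemma no_node_on_X:
  assumes r: "avoids_nodes r" and v: "v \<in> Xcone r" and g: "gradF v = c *s v"
  shows "v = 0"
proof (rule ccontr)
  assume v0: "v \<noteq> 0"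
  have Q: "(v$1)^2 + (v$2)^2 + (v$3)^2 + (v$4)^2 + (v$5)^2 + (v$6)^2 = 0"
    and F: "v$1 * v$2 * v$3 + \<i> * (v$4 * v$5 * v$6) = 0"
    and R: "r$1 * v$1 + r$2 * v$2 + r$3 * v$3 + r$4 * v$4 + r$5 * v$5 + r$6 * v$6 = 0"
    using v by (simp_all add: Xcone_def humQ_def humF_def hyp_iff_dot dot_6)
  have e: "v$2 * v$3 = c * v$1" "v$1 * v$3 = c * v$2" "v$1 * v$2 = c * v$3"
    "\<i> * (v$5 * v$6) = c * v$4" "\<i> * (v$4 * v$6) = c * v$5" "\<i> * (v$4 * v$5) = c * v$6"
    using g by (metis gradF_nth vector_smult_component)+
  show False
  proof (cases "c = 0")
    case True
    have x: "(v$2 = 0 \<and> v$3 = 0) \<or> (v$1 = 0 \<and> v$3 = 0) \<or> (v$1 = 0 \<and> v$2 = 0)"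
      using e True by auto
    have y: "(v$5 = 0 \<and> v$6 = 0) \<or> (v$4 = 0 \<and> v$6 = 0) \<or> (v$4 = 0 \<and> v$5 = 0)"
      using e True by auto
    obtain j k where jk: "j \<in> {1,2,3}" "k \<in> {4,5,6}" "\<forall>i. i \<noteq> j \<longrightarrow> i \<noteq> k \<longrightarrow> v$i = 0"
    proof -
      obtain j where "j \<in> {1,2,3}" "\<forall>i\<in>{1,2,3}. i \<noteq> j \<longrightarrow> v$i = 0"
        using x by (elim disjE) force+
      moreover obtain k where "k \<in> {4,5,6}" "\<forall>i\<in>{4,5,6}. i \<noteq> k \<longrightarrow> v$i = 0"
        using y by (elim disjE) force+
      ultimately show thesis using that[of j k] exhaust_6 by blast
    qed
    have "r$j * v$j + r$k * v$k = 0" "(v$j)^2 + (v$k)^2 = 0"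
      using jk Q R by auto
    moreover have "(r$j)^2 + (r$k)^2 \<noteq> 0" using r jk unfolding avoids_nodes_def by blast
    ultimately have "v$j = 0" "v$k = 0" using linear_relation_sum_squares by blast+
    then have "v$i = 0" for i using jk(3) by metis
    then show False using v0 by (simp add: vec_eq_iff)
  next
    case False
    \<comment> \<open>Multiplying each proportionality by its own coordinate makes all
      \<open>c * (v$i)^2\<close> equal to x1 x2 x3 up to sign, hence all coordinates equal up to
      fourth roots of unity.\<close>
    have "c * (v$1)^2 = v$1 * v$2 * v$3" "c * (v$2)^2 = v$1 * v$2 * v$3" "c * (v$3)^2 = v$1 * v$2 * v$3"
      using e by algebra+
    moreover have "c * (v$4)^2 = \<i> * (v$4 * v$5 * v$6)" "c * (v$5)^2 = \<i> * (v$4 * v$5 * v$6)"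
      "c * (v$6)^2 = \<i> * (v$4 * v$5 * v$6)"
      using e by algebra+
    moreover have "\<i> * (v$4 * v$5 * v$6) = - (v$1 * v$2 * v$3)" using F by algebra
    ultimately have "c * (v$2)^2 = c * (v$1)^2" "c * (v$3)^2 = c * (v$1)^2"
      "c * (v$4)^2 = c * (\<i> * v$1)^2" "c * (v$5)^2 = c * (\<i> * v$1)^2" "c * (v$6)^2 = c * (\<i> * v$1)^2"
      by (simp_all add: power_mult_distrib)
    then have sq: "(v$2)^2 = (v$1)^2" "(v$3)^2 = (v$1)^2" "(v$4)^2 = (\<i> * v$1)^2"
      "(v$5)^2 = (\<i> * v$1)^2" "(v$6)^2 = (\<i> * v$1)^2"
      using False by simp_all
    have sign: "\<exists>s\<in>{1,-1::complex}. x = s * y" if "x^2 = y^2" for x y :: complex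
      using that by (auto simp: power2_eq_iff)
    obtain s2 s3 s4 s5 s6 where s: "s2 \<in> {1,-1}" "s3 \<in> {1,-1}" "s4 \<in> {1,-1}" "s5 \<in> {1,-1}" "s6 \<in> {1,-1}"
      and vs: "v$2 = s2 * v$1" "v$3 = s3 * v$1" "v$4 = s4 * (\<i> * v$1)" "v$5 = s5 * (\<i> * v$1)" "v$6 = s6 * (\<i> * v$1)"
      using sq[THEN sign] by blast
    have "sign_form (s2, s3, s4, s5, s6) r * v$1 = 0"
      using R unfolding vs by (simp add: sign_form_def algebra_simps)
    moreover have "sign_form (s2, s3, s4, s5, s6) r \<noteq> 0"
      using r s unfolding avoids_nodes_def signs_def by blast
    ultimately have "v$1 = 0" by simp
    then have "v = 0" unfolding vec_eq_iff forall_6 vs by simp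
    then show False using v0 by simp
  qed
qed

lemma transversalI:
  assumes nodes: "avoids_nodes r" and S: "dot r r \<noteq> 0"
    and normal: "\<And>a w. humQ w = 0 \<Longrightarrow> humF w = 0 \<Longrightarrow> r \<noteq> a *s w + gradF w"
  shows "transversal r"
  unfolding transversal_def
proof (intro ballI impI allI)
  fix v a b c assume v: "v \<in> Xcone r" "v \<noteq> 0" and rel: "a *s gradQ v + b *s gradF v + c *s r = 0"
  have rel': "2 * a * v$i + b * gradF v $ i + c * r$i = 0" for i
    using rel[unfolded vec_eq_iff, rule_format, of i] by (simp add: gradQ_def mult_ac)
  have Q: "humQ v = 0" and F: "humF v = 0" using v(1) by (simp_all add: Xcone_def)
  have c: "c = 0"
  proof (rule ccontr)
    assume c: "c \<noteq> 0"
    define a' b' where ab: "a' = - 2 * a / c" "b' = - b / c"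
    have r: "r$i = a' * v$i + b' * gradF v $ i" for i
    proof -
      have "c * a' = - 2 * a" "c * b' = - b" using c by (simp_all add: ab)
      then have "c * r$i = c * (a' * v$i + b' * gradF v $ i)" using rel'[of i] by algebra
      then show ?thesis using c by simp
    qed
    \<comment> \<open>\<open>gradF\<close> is homogeneous of degree 2, so replacing \<open>v\<close>
      by \<open>t *s v\<close> absorbs the coefficient \<open>b'\<close> and brings \<open>r\<close>
      into the normal form with coefficient one. If \<open>t = 0\<close>, then \<open>r\<close> is a
      multiple of the isotropic vector \<open>v\<close>.\<close>
    define t where "t = csqrt b'"
    have t: "t^2 = b'" by (simp add: t_def)
    show False
    proof (cases "t = 0")
      case True
      then have "r = a' *s v" using r t by (simp add: vec_eq_iff)
      then show False using S Q by (simp add: humQ_dot bilinear_formD[OF bilinear_form_dot])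
    next
      case False
      have "r = (a' / t) *s (t *s v) + gradF (t *s v)"
        unfolding vec_eq_iff forall_6 vector_add_component vector_smult_component gradF_nth r
        using False t by (simp add: power2_eq_square)
      moreover have "humQ (t *s v) = 0" "humF (t *s v) = 0"
      proof -
        have "humQ (t *s v) = t^2 * humQ v" unfolding humQ_def vector_smult_component by algebra
        then show "humQ (t *s v) = 0" using Q by simp
        have "humF (t *s v) = t^3 * humF v" unfolding humF_def vector_smult_component by algebra
        then show "humF (t *s v) = 0" using F by simp
      qed
      ultimately show False using normal by blast
    qed
  qed
  have b: "b = 0"
  proof (rule ccontr)
    assume "b \<noteq> 0"
    have "gradF v $ i = (- 2 * a / b) * v$i" for i
    proof -
      have "b * (- 2 * a / b) = - 2 * a" using \<open>b \<noteq> 0\<close> by simp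
      then have "b * gradF v $ i = b * ((- 2 * a / b) * v$i)" using rel'[of i] c by algebra
      then show ?thesis using \<open>b \<noteq> 0\<close> mult_left_cancel by blast
    qed
    then have "gradF v = (- 2 * a / b) *s v" by (simp add: vec_eq_iff)
    then show False using no_node_on_X[OF nodes v(1)] v(2) by blast
  qed
  obtain i where "v$i \<noteq> 0" using v(2) by (auto simp: vec_eq_iff)
  then have "a = 0" using rel'[of i] b c by simp
  then show "a = 0 \<and> b = 0 \<and> c = 0" using b c by simp
qed

section \<open>Polynomial dependence of the covariants on the hyperplane\<close>

definition poly_vec :: "(complex^6 \<Rightarrow> complex^6) \<Rightarrow> bool" where
  "poly_vec f \<longleftrightarrow> (\<forall>i. poly_fun (\<lambda>r. f r $ i))"

definition poly_mat :: "(complex^6 \<Rightarrow> complex^6^6) \<Rightarrow> bool" where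
  "poly_mat A \<longleftrightarrow> (\<forall>i j. poly_fun (\<lambda>r. A r $ i $ j))"

lemma poly_fun_nth: "poly_vec f \<Longrightarrow> poly_fun (\<lambda>r. f r $ i)"
  by (simp add: poly_vec_def)

lemma poly_vec_const: "poly_vec (\<lambda>r. u)"
  by (simp add: poly_vec_def poly_fun_const)

lemma poly_vec_ident: "poly_vec (\<lambda>r. r)"
  by (simp add: poly_vec_def poly_fun_coord)

lemma poly_fun_dot: "poly_vec f \<Longrightarrow> poly_vec g \<Longrightarrow> poly_fun (\<lambda>r. dot (f r) (g r))"
  unfolding dot_def by (intro poly_fun_intros poly_fun_nth)

lemma poly_fun_F3: "poly_vec f \<Longrightarrow> poly_vec g \<Longrightarrow> poly_vec h \<Longrightarrow> poly_fun (\<lambda>r. F3 (f r) (g r) (h r))"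
  unfolding F3_def by (intro poly_fun_intros poly_fun_nth)

lemma poly_vec_proj: "poly_vec (\<lambda>r. proj r u)"
  unfolding poly_vec_def proj_def vector_minus_component vector_smult_component
  by (intro allI poly_fun_intros poly_fun_dot poly_vec_const poly_vec_ident)

lemma poly_fun_harm: "poly_fun (\<lambda>r. harm r u v w)"
  unfolding harm_def cyc_def
  by (intro poly_fun_intros poly_fun_dot poly_fun_F3 poly_vec_proj poly_vec_ident)

lemma poly_mat_slice: "poly_mat (\<lambda>r. slice r u)"
  unfolding poly_mat_def slice_def by (simp add: poly_fun_harm)

lemma poly_mat_transpose: "poly_mat A \<Longrightarrow> poly_mat (\<lambda>r. transpose (A r))"
  by (simp add: poly_mat_def transpose_def)

lemma poly_mat_mult: "poly_mat A \<Longrightarrow> poly_mat B \<Longrightarrow> poly_mat (\<lambda>r. A r ** B r)"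
  unfolding poly_mat_def matrix_matrix_mult_def by (simp add: poly_fun_sum poly_fun_mult)

lemma poly_fun_trace: "poly_mat A \<Longrightarrow> poly_fun (\<lambda>r. trace (A r))"
  unfolding poly_mat_def trace_def by (simp add: poly_fun_sum)

lemma poly_vec_mult: "poly_mat A \<Longrightarrow> poly_vec f \<Longrightarrow> poly_vec (\<lambda>r. A r *v f r)"
  unfolding poly_mat_def poly_vec_def matrix_vector_mult_def by (simp add: poly_fun_sum poly_fun_mult)

lemma poly_fun_det: "poly_mat A \<Longrightarrow> poly_fun (\<lambda>r. det (A r))"
  unfolding poly_mat_def det_def by (intro poly_fun_intros) blast

lemma poly_mat_Tmat: "poly_mat Tmat"
proof -
  have "poly_fun (\<lambda>r. trace (transpose (slice r u) ** slice r v))" for u v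
    by (intro poly_fun_trace poly_mat_mult poly_mat_transpose poly_mat_slice)
  then show ?thesis by (simp add: poly_mat_def Tmat_def)
qed

lemma poly_vec_wvec: "poly_vec wvec"
proof -
  have "poly_fun (\<lambda>r. trace (slice r u ** Tmat r))" for u
    by (intro poly_fun_trace poly_mat_mult poly_mat_slice poly_mat_Tmat)
  then show ?thesis by (simp add: poly_vec_def wvec_def)
qed

lemma poly_mat_krylov: "poly_mat krylov"
proof -
  have "poly_vec (\<lambda>r. krylov r $ i)" for i
    using exhaust_6[of i]
    by (auto simp: krylov_def Let_def vector_6
        intro!: poly_vec_mult poly_mat_Tmat poly_vec_wvec poly_vec_ident)
  then show ?thesis by (simp add: poly_mat_def poly_vec_def)
qed

lemma nontrivial_trace_Tmat: "nontrivial_poly (\<lambda>r. trace (Tmat r))"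
  by (rule nontrivial_polyI[OF poly_fun_trace[OF poly_mat_Tmat] trace_Tmat_r0])

lemma nontrivial_det_krylov: "nontrivial_poly (\<lambda>r. det (krylov r))"
  by (rule nontrivial_polyI[OF poly_fun_det[OF poly_mat_krylov] det_krylov_r0])

lemma nontrivial_coord: "nontrivial_poly (\<lambda>r. r$i)"
  by (rule nontrivial_polyI[of _ "axis i 1"]) (simp_all add: poly_fun_coord)

lemma nontrivial_sum_squares: "i \<noteq> j \<Longrightarrow> nontrivial_poly (\<lambda>r. (r$i)^2 + (r$j)^2)"
  by (rule nontrivial_polyI[of _ "axis i 1"]) (auto intro!: poly_fun_intros simp: axis_def)

lemma nontrivial_plane_form: "i \<noteq> j \<Longrightarrow> nontrivial_poly (\<lambda>r. \<i> * r$i + r$j)"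
  by (rule nontrivial_polyI[of _ "axis j 1"]) (auto intro!: poly_fun_intros simp: axis_def)

lemma nontrivial_dot: "nontrivial_poly (\<lambda>r. dot r r)"
  by (rule nontrivial_polyI[of _ r0]) (simp_all add: poly_fun_dot poly_vec_ident dot_r0_r0)

lemma nontrivial_sign_form: "nontrivial_poly (sign_form s)"
proof -
  obtain s2 s3 s4 s5 s6 where s: "s = (s2, s3, s4, s5, s6)" by (cases s)
  show ?thesis
    unfolding s sign_form_def prod.case
    by (rule nontrivial_polyI[of _ "axis 1 1"]) (auto intro!: poly_fun_intros simp: axis_def)
qed

text \<open>The locus contains a nonempty principal Zariski open set. Passing from
  \<open>nontrivial_poly\<close> to predicates lets conditions be combined without naming the
  product polynomial.\<close>

definition open_condition :: "(complex^6 \<Rightarrow> bool) \<Rightarrow> bool" where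
  "open_condition C \<longleftrightarrow> (\<exists>P. nontrivial_poly P \<and> (\<forall>r. P r \<noteq> 0 \<longrightarrow> C r))"

lemma open_conditionI: "nontrivial_poly P \<Longrightarrow> open_condition (\<lambda>r. P r \<noteq> 0)"
  unfolding open_condition_def by blast

lemma open_condition_conj:
  assumes "open_condition C" "open_condition D"
  shows "open_condition (\<lambda>r. C r \<and> D r)"
proof -
  obtain P Q where "nontrivial_poly P" "\<forall>r. P r \<noteq> 0 \<longrightarrow> C r" "nontrivial_poly Q" "\<forall>r. Q r \<noteq> 0 \<longrightarrow> D r"
    using assms unfolding open_condition_def by blast
  then show ?thesis unfolding open_condition_def
    by (intro exI[of _ "\<lambda>r. P r * Q r"]) (simp add: nontrivial_poly_mult)
qed

lemma open_condition_ball: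
  "finite A \<Longrightarrow> (\<And>a. a \<in> A \<Longrightarrow> open_condition (C a)) \<Longrightarrow> open_condition (\<lambda>r. \<forall>a\<in>A. C a r)"
proof (induction A rule: finite_induct)
  case empty
  then show ?case using open_conditionI[OF nontrivial_polyI[OF poly_fun_const[of 1]]] by simp
next
  case (insert a A)
  then have "open_condition (\<lambda>r. C a r \<and> (\<forall>a\<in>A. C a r))" by (intro open_condition_conj) auto
  then show ?case by simp
qed

lemma open_condition_generic_coords: "open_condition generic_coords"
proof -
  have "open_condition (\<lambda>r. (\<forall>i\<in>UNIV. r$i \<noteq> 0) \<and> (r$1)^2 + (r$2)^2 \<noteq> 0 \<and> (r$1)^2 + (r$3)^2 \<noteq> 0 \<and>
     (r$2)^2 + (r$3)^2 \<noteq> 0 \<and> \<i> * r$1 + r$4 \<noteq> 0 \<and> \<i> * r$2 + r$5 \<noteq> 0 \<and> \<i> * r$3 + r$6 \<noteq> 0)"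
    by (intro open_condition_conj open_condition_ball open_conditionI nontrivial_coord
        nontrivial_sum_squares nontrivial_plane_form) simp_all
  then show ?thesis by (simp add: generic_coords_def[abs_def])
qed

lemma open_condition_avoids_nodes: "open_condition avoids_nodes"
  unfolding avoids_nodes_def[abs_def]
  by (intro open_condition_conj open_condition_ball open_conditionI nontrivial_sum_squares nontrivial_sign_form)
    (auto simp: signs_def)

theorem theorem5p2:
  shows "\<exists>P. poly_fun P \<and> (\<exists>r. P r \<noteq> 0) \<and>
     (\<forall>r. r \<noteq> 0 \<and> P r \<noteq> 0 \<longrightarrow>
        transversal r \<and> (\<forall>M. preserves_X r M \<longrightarrow> trivial_on_R r M))"
proof -
  obtain Z where Z: "nontrivial_poly Z"
    "\<And>a w. humQ w = 0 \<Longrightarrow> humF w = 0 \<Longrightarrow> Z (a *s w + gradF w) = 0"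
    using normals_not_dense by blast
  have "open_condition (\<lambda>r. generic_coords r \<and> avoids_nodes r \<and> dot r r \<noteq> 0 \<and> Z r \<noteq> 0 \<and>
      trace (Tmat r) \<noteq> 0 \<and> det (krylov r) \<noteq> 0)"
    by (intro open_condition_conj open_condition_generic_coords open_condition_avoids_nodes open_conditionI
        Z(1) nontrivial_dot nontrivial_trace_Tmat nontrivial_det_krylov)
  then obtain P where P: "nontrivial_poly P"
    "\<And>r. P r \<noteq> 0 \<Longrightarrow> generic_coords r \<and> avoids_nodes r \<and> dot r r \<noteq> 0 \<and> Z r \<noteq> 0 \<and>
      trace (Tmat r) \<noteq> 0 \<and> det (krylov r) \<noteq> 0"
    unfolding open_condition_def by blast
  have "transversal r \<and> (\<forall>M. preserves_X r M \<longrightarrow> trivial_on_R r M)" if "P r \<noteq> 0" for r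
  proof -
    note r = P(2)[OF that]
    have "transversal r"
    proof (rule transversalI)
      show "r \<noteq> a *s w + gradF w" if "humQ w = 0" "humF w = 0" for a w
        using Z(2)[OF that] r by metis
    qed (use r in blast)+
    then show ?thesis using automorphism_trivial r by blast
  qed
  then show ?thesis using P(1) unfolding nontrivial_poly_def by blast
qed

end
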